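(* Let $S$ be a semispray on $M$ and let $\theta$ be a semi-basic $1$-form on $TM\setminus\{0\}$. Then the $1$-form $\mathcal{L}_S\theta$ is closed if and only if $\theta$ satisfies the following four conditions (the Helmholtz conditions): $$d_h\theta=0,\qquad d_J\theta=0,\qquad \nabla d\theta=0,\qquad d_{\Phi}\theta=0.$$ Here $h$, $\Phi$ and $\nabla$ are the horizontal projector, the Jacobi endomorphism and the dynamical covariant derivative induced by $S$, and $J$ is the tangent structure.
   Context: $M$ is a smooth ($C^\infty$) second countable Hausdorff manifold of dimension $n\ge 1$; $\pi:TM\to M$ is the tangent bundle and $TM\setminus\{0\}$ is the tangent bundle with the zero section removed. Coordinates $x^i$ on $M$ induce coordinates $(x^i,y^i)$ on $TM$. All objects are $C^\infty$-smooth. Forms and derivations. $\Lambda^k(TM\setminus\{0\})$ is the module of $k$-forms. For a $(1,1)$-type tensor field $A$ and a $k$-form $\alpha$ with $k\ge 1$, $i_A\alpha(X_1,\dots,X_k)=\sum_{i=1}^k\alpha(X_1,\dots,AX_i,\dots,X_k)$, and $i_A f=0$ for functions $f$. Set $d_A=i_A\circ d-d\circ i_A$. For a vector field $X$, $\mathcal{L}_X$ is the Lie derivative; on a $(1,1)$-tensor $A$, $\mathcal{L}_XA=\mathcal{L}_X\circ A-A\circ\mathcal{L}_X$ (as maps on vector fields). Vertical structures. The vertical distribution $V$ is $\ker D\pi$. The Liouville vector field is $\mathbb{C}=y^i\frac{\partial}{\partial y^i}$. The tangent structure is the $(1,1)$-tensor $J=\frac{\partial}{\partial y^i}\otimes dx^i$.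 A $1$-form $\theta$ on $TM\setminus\{0\}$ is semi-basic if it vanishes on vertical vectors (locally $\theta=\theta_i(x,y)dx^i$). Semisprays. A semispray on $M$ is a vector field $S$ on $TM\setminus\{0\}$ with $JS=\mathbb{C}$. It induces the horizontal and vertical projectors $h=\frac12(\mathrm{Id}-\mathcal{L}_SJ)$, $v=\frac12(\mathrm{Id}+\mathcal{L}_SJ)$ and the Jacobi endomorphism $\Phi=v\circ\mathcal{L}_Sh$ (a $(1,1)$-tensor). Dynamical covariant derivative. $\nabla$ is the unique tensor derivation on $TM\setminus\{0\}$ (an $\mathbb{R}$-linear, type preserving map of the tensor algebra satisfying the Leibniz rule for $\otimes$ and commuting with contractions) such that $\nabla f=S(f)$ for functions $f$ and $\nabla X=h[S,hX]+v[S,vX]$ for vector fields $X$. Thus for a $k$-form $\omega$, $(\nabla\omega)(X_1,\dots,X_k)=S(\omega(X_1,\dots,X_k))-\sum_{i=1}^k\omega(X_1,\dots,\nabla X_i,\dots,X_k)$. *)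

theory Defs
  imports "HOL-Analysis.Analysis"
begin

section \<open>Smooth manifolds\<close>

text \<open>Smoothness on an open subset of a Euclidean space: all iterated directional derivatives
  exist and are continuous. Only used for open \<open>S\<close>.\<close>

fun times_differentiable_on ::
  "nat \<Rightarrow> ('e::euclidean_space \<Rightarrow> 'f::real_normed_vector) \<Rightarrow> 'e set \<Rightarrow> bool" where
  "times_differentiable_on 0 f S \<longleftrightarrow> continuous_on S f"
| "times_differentiable_on (Suc k) f S \<longleftrightarrow>
     (\<forall>x\<in>S. f differentiable (at x)) \<and>
     (\<forall>e. times_differentiable_on k (\<lambda>x. frechet_derivative f (at x) e) S)"

definition smooth_on :: "('e::euclidean_space \<Rightarrow> 'f::real_normed_vector) \<Rightarrow> 'e set \<Rightarrow> bool" where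
  "smooth_on f S \<longleftrightarrow> (\<forall>k. times_differentiable_on k f S)"

text \<open>A chart is a pair \<open>(U, \<phi>)\<close> of a domain and a coordinate map (whose values outside \<open>U\<close> are
  irrelevant). The manifold carries the topology determined by its atlas, that is, the one in
  which the charts are homeomorphisms from open sets onto their images.\<close>

type_synonym ('p, 'e) chart = "'p set \<times> ('p \<Rightarrow> 'e)"
type_synonym ('p, 'e) atlas = "('p, 'e) chart set"

definition points :: "('p, 'e) atlas \<Rightarrow> 'p set" where
  "points A = \<Union> (fst ` A)"

definition smooth_atlas :: "('p, 'e::euclidean_space) atlas \<Rightarrow> bool" where
  "smooth_atlas A \<longleftrightarrow>
     (\<forall>(U, \<phi>)\<in>A. inj_on \<phi> U \<and> open (\<phi> ` U)) \<and>
     (\<forall>(U, \<phi>)\<in>A. \<forall>(V, \<psi>)\<in>A.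
        open (\<phi> ` (U \<inter> V)) \<and> smooth_on (\<psi> \<circ> inv_into U \<phi>) (\<phi> ` (U \<inter> V)))"

definition atlas_topology :: "('p, 'e::euclidean_space) atlas \<Rightarrow> 'p topology" where
  "atlas_topology A =
     topology (\<lambda>W. W \<subseteq> points A \<and> (\<forall>(U, \<phi>)\<in>A. open (\<phi> ` (U \<inter> W))))"

definition smooth_manifold :: "('p, 'e::euclidean_space) atlas \<Rightarrow> bool" where
  "smooth_manifold A \<longleftrightarrow> smooth_atlas A \<and>
     Hausdorff_space (atlas_topology A) \<and> second_countable (atlas_topology A)"

definition smooth_fun_on :: "('p, 'e::euclidean_space) atlas \<Rightarrow> 'p set \<Rightarrow> ('p \<Rightarrow> real) \<Rightarrow> bool" where
  "smooth_fun_on A W f \<longleftrightarrow>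
     (\<forall>(U, \<phi>)\<in>A. smooth_on (f \<circ> inv_into U \<phi>) (\<phi> ` (U \<inter> W)))"

definition smooth_near :: "('p, 'e::euclidean_space) atlas \<Rightarrow> 'p \<Rightarrow> ('p \<Rightarrow> real) \<Rightarrow> bool" where
  "smooth_near A p f \<longleftrightarrow> (\<exists>W. openin (atlas_topology A) W \<and> p \<in> W \<and> smooth_fun_on A W f)"

section \<open>Tangent vectors\<close>

text \<open>Tangent vectors at \<open>p\<close> are derivations of the functions that are smooth near \<open>p\<close>. Such a
  derivation depends only on germs: if \<open>f\<close> vanishes near \<open>p\<close>, multiply it by the indicator
  function of a neighbourhood of \<open>p\<close>. On all other functions its value is fixed to be \<open>0\<close>, so
  that equality of tangent vectors is equality of HOL functions.\<close>

type_synonym 'p tangent_vector = "('p \<Rightarrow> real) \<Rightarrow> real"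

definition tangent_space :: "('p, 'e::euclidean_space) atlas \<Rightarrow> 'p \<Rightarrow> 'p tangent_vector set" where
  "tangent_space A p = {v.
     (\<forall>f g. smooth_near A p f \<longrightarrow> smooth_near A p g \<longrightarrow>
        v (\<lambda>q. f q + g q) = v f + v g \<and>
        v (\<lambda>q. f q * g q) = v f * g p + f p * v g) \<and>
     (\<forall>c f. smooth_near A p f \<longrightarrow> v (\<lambda>q. c * f q) = c * v f) \<and>
     (\<forall>f. \<not> smooth_near A p f \<longrightarrow> v f = 0)}"

text \<open>The derivative at \<open>p\<close> in the coordinate direction \<open>e\<close> of a chart around \<open>p\<close>.\<close>

definition coord_vector ::
  "('p, 'e::euclidean_space) atlas \<Rightarrow> ('p, 'e) chart \<Rightarrow> 'e \<Rightarrow> 'p \<Rightarrow> 'p tangent_vector" where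
  "coord_vector A c e p = (\<lambda>f. if smooth_near A p f
     then frechet_derivative (f \<circ> inv_into (fst c) (snd c)) (at (snd c p)) e else 0)"

definition differential ::
  "('q, 'd::euclidean_space) atlas \<Rightarrow> ('p \<Rightarrow> 'q) \<Rightarrow> 'p \<Rightarrow> 'p tangent_vector \<Rightarrow> 'q tangent_vector"
  where
  "differential B F p v = (\<lambda>g. if smooth_near B (F p) g then v (g \<circ> F) else 0)"

section \<open>Vector fields, forms and derivations\<close>

type_synonym 'p vfield = "'p \<Rightarrow> 'p tangent_vector"

text \<open>Vector fields are smooth sections of the tangent bundle, defined on all of the manifold and
  set to zero outside its set of points (again for extensionality).\<close>

definition vector_fields :: "('p, 'e::euclidean_space) atlas \<Rightarrow> 'p vfield set" where
  "vector_fields A = {X.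
     (\<forall>p\<in>points A. X p \<in> tangent_space A p) \<and>
     (\<forall>p. p \<notin> points A \<longrightarrow> X p = (\<lambda>f. 0)) \<and>
     (\<forall>W f. openin (atlas_topology A) W \<longrightarrow> smooth_fun_on A W f \<longrightarrow>
        smooth_fun_on A W (\<lambda>p. X p f))}"

definition vf_add :: "'p vfield \<Rightarrow> 'p vfield \<Rightarrow> 'p vfield" where
  "vf_add X Y = (\<lambda>p f. X p f + Y p f)"

definition vf_diff :: "'p vfield \<Rightarrow> 'p vfield \<Rightarrow> 'p vfield" where
  "vf_diff X Y = (\<lambda>p f. X p f - Y p f)"

definition vf_scale :: "('p \<Rightarrow> real) \<Rightarrow> 'p vfield \<Rightarrow> 'p vfield" where
  "vf_scale a X = (\<lambda>p f. a p * X p f)"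

text \<open>The test for smoothness is needed because \<open>\<lambda>q. Y q f\<close> can be smooth near \<open>p\<close> although \<open>f\<close>
  is not.\<close>

definition lie_bracket ::
  "('p, 'e::euclidean_space) atlas \<Rightarrow> 'p vfield \<Rightarrow> 'p vfield \<Rightarrow> 'p vfield" where
  "lie_bracket A X Y = (\<lambda>p f. if smooth_near A p f
     then X p (\<lambda>q. Y q f) - Y p (\<lambda>q. X q f) else 0)"

text \<open>A \<open>(1,1)\<close>-tensor field is treated as a map on vector fields, and a \<open>k\<close>-form as an alternating
  map, multilinear over the smooth functions, from lists of \<open>k\<close> vector fields to smooth functions.
  Only the values at points of the manifold are meaningful.\<close>

type_synonym 'p tensor11 = "'p vfield \<Rightarrow> 'p vfield"
type_synonym 'p form = "'p vfield list \<Rightarrow> 'p \<Rightarrow> real"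

definition vf_tuples :: "('p, 'e::euclidean_space) atlas \<Rightarrow> nat \<Rightarrow> 'p vfield list set" where
  "vf_tuples A k = {Xs. length Xs = k \<and> set Xs \<subseteq> vector_fields A}"

definition differential_forms :: "('p, 'e::euclidean_space) atlas \<Rightarrow> nat \<Rightarrow> 'p form set" where
  "differential_forms A k = {\<omega>.
     (\<forall>Xs\<in>vf_tuples A k. smooth_fun_on A (points A) (\<omega> Xs)) \<and>
     (\<forall>Xs\<in>vf_tuples A k. \<forall>i<k. \<forall>X\<in>vector_fields A. \<forall>Y\<in>vector_fields A. \<forall>a b.
        smooth_fun_on A (points A) a \<longrightarrow> smooth_fun_on A (points A) b \<longrightarrow>
        (\<forall>p\<in>points A. \<omega> (Xs[i := vf_add (vf_scale a X) (vf_scale b Y)]) p =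
           a p * \<omega> (Xs[i := X]) p + b p * \<omega> (Xs[i := Y]) p)) \<and>
     (\<forall>Xs\<in>vf_tuples A k. \<forall>j<k. \<forall>i<j. Xs ! i = Xs ! j \<longrightarrow> (\<forall>p\<in>points A. \<omega> Xs p = 0))}"

definition vanishes :: "('p, 'e::euclidean_space) atlas \<Rightarrow> nat \<Rightarrow> 'p form \<Rightarrow> bool" where
  "vanishes A k \<omega> \<longleftrightarrow> (\<forall>Xs\<in>vf_tuples A k. \<forall>p\<in>points A. \<omega> Xs p = 0)"

definition omit :: "nat \<Rightarrow> 'b list \<Rightarrow> 'b list" where
  "omit i xs = take i xs @ drop (Suc i) xs"

text \<open>The exterior derivative, by the invariant formula
  \<open>d\<omega>(X\<^sub>0,\<dots>,X\<^sub>k) = \<Sum>\<^sub>i (-1)\<^sup>i X\<^sub>i(\<omega>(\<dots>)) + \<Sum>\<^sub>i\<^sub><\<^sub>j (-1)\<^sup>i\<^sup>+\<^sup>j \<omega>([X\<^sub>i,X\<^sub>j],\<dots>)\<close>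
  (normalised so that \<open>d\<theta>(X,Y) = X(\<theta> Y) - Y(\<theta> X) - \<theta>[X,Y]\<close>).\<close>

definition ext_deriv :: "('p, 'e::euclidean_space) atlas \<Rightarrow> 'p form \<Rightarrow> 'p form" where
  "ext_deriv A \<omega> = (\<lambda>Xs p.
     (\<Sum>i<length Xs. (-1) ^ i * (Xs ! i) p (\<omega> (omit i Xs))) +
     (\<Sum>j<length Xs. \<Sum>i<j.
        (-1) ^ (i + j) * \<omega> (lie_bracket A (Xs ! i) (Xs ! j) # omit i (omit j Xs)) p))"

definition closed_form :: "('p, 'e::euclidean_space) atlas \<Rightarrow> nat \<Rightarrow> 'p form \<Rightarrow> bool" where
  "closed_form A k \<omega> \<longleftrightarrow> vanishes A (Suc k) (ext_deriv A \<omega>)"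

text \<open>For the empty list, that is, on functions, the sum is empty and \<open>i\<^sub>T f = 0\<close>.\<close>

definition insertion :: "'p tensor11 \<Rightarrow> 'p form \<Rightarrow> 'p form" where
  "insertion T \<omega> = (\<lambda>Xs p. \<Sum>i<length Xs. \<omega> (Xs[i := T (Xs ! i)]) p)"

definition tensor_deriv :: "('p, 'e::euclidean_space) atlas \<Rightarrow> 'p tensor11 \<Rightarrow> 'p form \<Rightarrow> 'p form" where
  "tensor_deriv A T \<omega> = (\<lambda>Xs p.
     insertion T (ext_deriv A \<omega>) Xs p - ext_deriv A (insertion T \<omega>) Xs p)"

definition lie_form :: "('p, 'e::euclidean_space) atlas \<Rightarrow> 'p vfield \<Rightarrow> 'p form \<Rightarrow> 'p form" where
  "lie_form A X \<omega> = (\<lambda>Xs p.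
     X p (\<omega> Xs) - (\<Sum>i<length Xs. \<omega> (Xs[i := lie_bracket A X (Xs ! i)]) p))"

definition lie_tensor ::
  "('p, 'e::euclidean_space) atlas \<Rightarrow> 'p vfield \<Rightarrow> 'p tensor11 \<Rightarrow> 'p tensor11" where
  "lie_tensor A X T = (\<lambda>Y. vf_diff (lie_bracket A X (T Y)) (T (lie_bracket A X Y)))"

section \<open>The slit tangent bundle\<close>

text \<open>Points of \<open>TM\<close> are pairs \<open>(p, v)\<close> with \<open>v\<close> tangent at \<open>p\<close>, the projection is \<^const>\<open>fst\<close>, and
  a chart \<open>(U, x)\<close> of \<open>M\<close> induces the chart with coordinates \<open>x\<^sup>i(p)\<close>, \<open>y\<^sup>i = v(x\<^sup>i)\<close>.\<close>

type_synonym 'p tpoint = "'p \<times> 'p tangent_vector"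

definition induced_chart ::
  "('p, real^'n) atlas \<Rightarrow> ('p, real^'n) chart \<Rightarrow> ('p tpoint, (real^'n) \<times> (real^'n)) chart" where
  "induced_chart A c =
     (SIGMA p : fst c. tangent_space A p,
      \<lambda>(p, v). (snd c p, \<chi> i. v (\<lambda>q. snd c q $ i)))"

definition tangent_bundle ::
  "('p, real^'n) atlas \<Rightarrow> ('p tpoint, (real^'n) \<times> (real^'n)) atlas" where
  "tangent_bundle A = induced_chart A ` A"

definition restrict_atlas :: "'p set \<Rightarrow> ('p, 'e) atlas \<Rightarrow> ('p, 'e) atlas" where
  "restrict_atlas W A = (\<lambda>(U, \<phi>). (U \<inter> W, \<phi>)) ` A"

definition slit_tangent_bundle ::
  "('p, real^'n) atlas \<Rightarrow> ('p tpoint, (real^'n) \<times> (real^'n)) atlas" where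
  "slit_tangent_bundle A = restrict_atlas {u. snd u \<noteq> (\<lambda>f. 0)} (tangent_bundle A)"

text \<open>The Liouville field and the tangent structure are given by coordinate expressions
  that do not depend on the chart; so at each point any chart around its projection may be used.\<close>

definition chart_at :: "('p, 'e) atlas \<Rightarrow> 'p \<Rightarrow> ('p, 'e) chart" where
  "chart_at A p = (SOME c. c \<in> A \<and> p \<in> fst c)"

definition d_dy ::
  "('p, real^'n) atlas \<Rightarrow> ('p, real^'n) chart \<Rightarrow> 'n \<Rightarrow> 'p tpoint \<Rightarrow> 'p tpoint tangent_vector" where
  "d_dy A c i = coord_vector (slit_tangent_bundle A) (induced_chart A c) (0, axis i 1)"

definition liouville :: "('p, real^'n) atlas \<Rightarrow> 'p tpoint vfield" where
  "liouville A = (\<lambda>u f. let c = chart_at A (fst u) in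
     \<Sum>i\<in>UNIV. (snd (snd (induced_chart A c) u) $ i) * d_dy A c i u f)"

text \<open>The coefficient \<open>dx\<^sup>i(X)\<close> is \<open>X\<close> applied to the function \<open>x\<^sup>i\<close> on the bundle.\<close>

definition tangent_structure :: "('p, real^'n) atlas \<Rightarrow> 'p tpoint tensor11" where
  "tangent_structure A X = (\<lambda>u f. let c = chart_at A (fst u) in
     \<Sum>i\<in>UNIV. X u (\<lambda>w. snd c (fst w) $ i) * d_dy A c i u f)"

definition vertical_space :: "('p, real^'n) atlas \<Rightarrow> 'p tpoint \<Rightarrow> 'p tpoint tangent_vector set" where
  "vertical_space A u =
     {\<xi> \<in> tangent_space (slit_tangent_bundle A) u. differential A fst u \<xi> = (\<lambda>g. 0)}"

definition semi_basic :: "('p, real^'n) atlas \<Rightarrow> 'p tpoint form \<Rightarrow> bool" where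
  "semi_basic A \<theta> \<longleftrightarrow> \<theta> \<in> differential_forms (slit_tangent_bundle A) 1 \<and>
     (\<forall>X\<in>vector_fields (slit_tangent_bundle A). \<forall>u\<in>points (slit_tangent_bundle A).
        X u \<in> vertical_space A u \<longrightarrow> \<theta> [X] u = 0)"

section \<open>Geometry of a semispray\<close>

definition semispray :: "('p, real^'n) atlas \<Rightarrow> 'p tpoint vfield \<Rightarrow> bool" where
  "semispray A S \<longleftrightarrow> S \<in> vector_fields (slit_tangent_bundle A) \<and>
     (\<forall>u\<in>points (slit_tangent_bundle A). tangent_structure A S u = liouville A u)"

definition hor :: "('p, real^'n) atlas \<Rightarrow> 'p tpoint vfield \<Rightarrow> 'p tpoint tensor11" where
  "hor A S X = vf_scale (\<lambda>u. 1/2)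
     (vf_diff X (lie_tensor (slit_tangent_bundle A) S (tangent_structure A) X))"

definition ver :: "('p, real^'n) atlas \<Rightarrow> 'p tpoint vfield \<Rightarrow> 'p tpoint tensor11" where
  "ver A S X = vf_scale (\<lambda>u. 1/2)
     (vf_add X (lie_tensor (slit_tangent_bundle A) S (tangent_structure A) X))"

definition jacobi_endo :: "('p, real^'n) atlas \<Rightarrow> 'p tpoint vfield \<Rightarrow> 'p tpoint tensor11" where
  "jacobi_endo A S X = ver A S (lie_tensor (slit_tangent_bundle A) S (hor A S) X)"

definition nabla_vf :: "('p, real^'n) atlas \<Rightarrow> 'p tpoint vfield \<Rightarrow> 'p tpoint tensor11" where
  "nabla_vf A S X = vf_add
     (hor A S (lie_bracket (slit_tangent_bundle A) S (hor A S X)))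
     (ver A S (lie_bracket (slit_tangent_bundle A) S (ver A S X)))"

text \<open>The extension to forms as a tensor derivation with \<open>\<nabla>f = S(f)\<close> (which is the case of the
  empty list).\<close>

definition nabla_form ::
  "('p, real^'n) atlas \<Rightarrow> 'p tpoint vfield \<Rightarrow> 'p tpoint form \<Rightarrow> 'p tpoint form" where
  "nabla_form A S \<omega> = (\<lambda>Xs u.
     S u (\<omega> Xs) - (\<Sum>i<length Xs. \<omega> (Xs[i := nabla_vf A S (Xs ! i)]) u))"

end

theory Submission
  imports Defs
begin

text \<open>Write \<open>D = [S, \<cdot>]\<close>, \<open>\<omega> = d\<theta>\<close>, and \<open>\<pi>\<close> for the projection. Since \<open>d\<close> commutes with the Lie derivative,
  closedness of \<open>L\<^sub>S\<theta>\<close> means \<open>L\<^sub>S\<omega> = 0\<close>. The proof computes with global vector fields on the slit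
  tangent bundle; no partition of unity and no local frame of semi-basic forms enters.

  The geometry that is needed is small. A tangent vector of the bundle is determined by its values
  on pullbacks \<open>g \<circ> \<pi>\<close> and on fibrewise linear functions \<open>lift g : (p, v) \<mapsto> v g\<close>
  (\<open>slit_tangent_eqI\<close>, a consequence of Hadamard's lemma). On these functions \<open>J\<close> and \<open>S\<close> act by
  \<open>JX (g \<circ> \<pi>) = 0\<close>, \<open>JX (lift g) = X (g \<circ> \<pi>)\<close> and \<open>S (g \<circ> \<pi>) = lift g\<close>
  (\<open>tangent_structure_apply\<close>, \<open>semispray_pullback\<close>). Two identities follow at once:
  \<open>J[S, Z] = -Z\<close> for vertical \<open>Z\<close>, and \<open>[S, JX] + X\<close> is vertical. The first makes
  \<open>N = L\<^sub>SJ\<close> the identity on vertical fields and the two together give the projectors \<open>h\<close>, \<open>v\<close>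
  with vertical image of \<open>v\<close>.

  As \<open>\<theta>\<close> is semi-basic and vertical fields are closed under brackets, \<open>\<omega>\<close> vanishes on pairs of
  vertical fields. Hence the Helmholtz conditions are statements on \<open>\<omega>\<close> alone: \<open>d\<^sub>J\<theta> = i\<^sub>J\<omega>\<close>,
  \<open>d\<^sub>\<Phi>\<theta> = i\<^sub>\<Phi>\<omega>\<close>, and \<open>d\<^sub>h\<theta>(X,Y) = \<omega>(hX,hY)\<close>. From \<open>D = \<nabla> + \<Phi> + K\<close> with \<open>K = hDv\<close> one gets
  \<open>L\<^sub>S\<omega> = \<nabla>\<omega> - i\<^sub>\<Phi>\<omega> - i\<^sub>K\<omega>\<close>, and \<open>JK = -v\<close> turns \<open>i\<^sub>K\<omega>(X,Y)\<close> into \<open>-i\<^sub>J\<omega>(KX,KY)\<close> once \<open>\<omega>(h\<cdot>,h\<cdot>) = 0\<close>. So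
  \<open>L\<^sub>S\<omega> = \<nabla>\<omega> - i\<^sub>\<Phi>\<omega>\<close> whenever \<open>d\<^sub>h\<theta> = 0\<close> and \<open>d\<^sub>J\<theta> = 0\<close> (\<open>lie_eq_nabla_minus_jacobi\<close>), and the
  four conditions imply closedness.

  Conversely let \<open>L\<^sub>S\<omega> = 0\<close>. Differentiating \<open>\<omega>(JX,JY) = 0\<close> along \<open>S\<close> gives \<open>i\<^sub>J\<omega> = 0\<close>;
  differentiating that gives \<open>i\<^sub>N\<omega> = 0\<close>, which on horizontal fields is \<open>\<omega>(hX,hY) = 0\<close>. Now
  \<open>\<nabla>\<omega> = i\<^sub>\<Phi>\<omega>\<close>. The right hand side depends only on \<open>hX\<close> and \<open>hY\<close>, whereas the left hand side
  vanishes on horizontal fields because \<open>\<nabla>\<close> preserves them; so both sides are zero.\<close>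

section \<open>Smooth maps between Euclidean spaces\<close>

lemma times_differentiable_cong:
  assumes "open S" "\<And>x. x \<in> S \<Longrightarrow> f x = g x" "times_differentiable_on k f S"
  shows "times_differentiable_on k g S"
  using assms(2-)
proof (induction k arbitrary: f g)
  case 0
  then show ?case by (simp cong: continuous_on_cong)
next
  case (Suc k)
  have D: "(g has_derivative frechet_derivative f (at x)) (at x)" if "x \<in> S" for x
    by (rule has_derivative_transform_within_open[of f _ x UNIV S])
      (use assms(1) Suc.prems that in \<open>auto simp: frechet_derivative_works\<close>)
  have "times_differentiable_on k (\<lambda>x. frechet_derivative g (at x) e) S" for e
    by (rule Suc.IH[of "\<lambda>x. frechet_derivative f (at x) e"])
      (use Suc.prems(2) frechet_derivative_at[OF D] in auto)
  then show ?case
    using D by (auto simp: differentiable_def)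
qed

text \<open>Induction on the order of differentiability needs a derivative only up to equality on the open
  set: this form replaces the canonical derivative by any expression for it.\<close>

lemma times_differentiableI:
  assumes "open S" and D: "\<And>x. x \<in> S \<Longrightarrow> (f has_derivative D x) (at x)"
    and "\<And>e. times_differentiable_on k (\<lambda>x. D x e) S"
  shows "times_differentiable_on (Suc k) f S"
proof -
  have "times_differentiable_on k (\<lambda>x. frechet_derivative f (at x) e) S" for e
    by (rule times_differentiable_cong[OF assms(1) _ assms(3)[of e]])
      (use frechet_derivative_at[OF D] in auto)
  then show ?thesis
    using D by (auto simp: differentiable_def)
qed

lemma times_differentiable_Suc_derivative:
  "times_differentiable_on (Suc k) f S \<Longrightarrow> x \<in> S \<Longrightarrow>
    (f has_derivative frechet_derivative f (at x)) (at x)"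
  by (auto simp: frechet_derivative_works)

lemma times_differentiable_SucD:
  "times_differentiable_on (Suc k) f S \<Longrightarrow> times_differentiable_on k f S"
proof (induction k arbitrary: f)
  case 0
  then show ?case
    by (auto intro!: continuous_at_imp_continuous_on differentiable_imp_continuous_within)
qed auto

lemma times_differentiable_subset:
  "times_differentiable_on k f T \<Longrightarrow> S \<subseteq> T \<Longrightarrow> times_differentiable_on k f S"
  by (induction k arbitrary: f) (auto intro: continuous_on_subset)

lemma times_differentiable_local:
  assumes "\<And>x. x \<in> S \<Longrightarrow> \<exists>U. open U \<and> x \<in> U \<and> times_differentiable_on k f U"
  shows "times_differentiable_on k f S"
  using assms
proof (induction k arbitrary: f)
  case 0
  have "isCont f x" if "x \<in> S" for x
    using 0[OF that] by (auto simp: continuous_on_eq_continuous_at)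
  then show ?case
    by (simp add: continuous_at_imp_continuous_on)
next
  case (Suc k)
  have "times_differentiable_on k (\<lambda>x. frechet_derivative f (at x) e) S" for e
    by (rule Suc.IH) (use Suc.prems in fastforce)
  then show ?case using Suc.prems by fastforce
qed

lemma times_differentiable_const: "times_differentiable_on k (\<lambda>x. c) S"
  by (induction k arbitrary: c) (auto simp: frechet_derivative_const)

lemma times_differentiable_bounded_linear:
  assumes "bounded_linear L" "open S" "times_differentiable_on k f S"
  shows "times_differentiable_on k (\<lambda>x. L (f x)) S"
  using assms(3)
proof (induction k arbitrary: f)
  case 0
  then show ?case using assms(1) by (auto intro: bounded_linear.continuous_on)
next
  case (Suc k)
  show ?case
    by (rule times_differentiableI[OF assms(2) bounded_linear.has_derivative[OF assms(1)
          times_differentiable_Suc_derivative[OF Suc.prems]]])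
      (use Suc in auto)
qed

lemma times_differentiable_add:
  assumes "open S" "times_differentiable_on k f S" "times_differentiable_on k g S"
  shows "times_differentiable_on k (\<lambda>x. f x + g x) S"
  using assms(2-)
proof (induction k arbitrary: f g)
  case (Suc k)
  show ?case
    by (rule times_differentiableI[OF assms(1) has_derivative_add[OF
          times_differentiable_Suc_derivative[OF Suc.prems(1)]
          times_differentiable_Suc_derivative[OF Suc.prems(2)]]])
      (use Suc in auto)
qed (auto intro: continuous_on_add)

lemma times_differentiable_sum:
  assumes "open S" "\<And>i. i \<in> I \<Longrightarrow> times_differentiable_on k (f i) S"
  shows "times_differentiable_on k (\<lambda>x. \<Sum>i\<in>I. f i x) S"
  using assms(2)
  by (induction I rule: infinite_finite_induct)
    (auto intro: times_differentiable_const times_differentiable_add[OF assms(1)])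

lemma times_differentiable_scaleR:
  assumes "open S" "times_differentiable_on k f S" "times_differentiable_on k g S"
  shows "times_differentiable_on k (\<lambda>x. f x *\<^sub>R g x) S"
  using assms(2-)
proof (induction k arbitrary: f g)
  case (Suc k)
  show ?case
    by (rule times_differentiableI[OF assms(1) has_derivative_scaleR[OF
          times_differentiable_Suc_derivative[OF Suc.prems(1)]
          times_differentiable_Suc_derivative[OF Suc.prems(2)]]])
      (use Suc times_differentiable_SucD[OF Suc.prems(1)] times_differentiable_SucD[OF Suc.prems(2)]
        in \<open>auto intro!: times_differentiable_add[OF assms(1)]\<close>)
qed (auto intro: continuous_on_scaleR)

lemma linear_basis_expansion:
  fixes x :: "'e::euclidean_space"
  assumes "linear L"
  shows "L x = (\<Sum>b\<in>Basis. (x \<bullet> b) *\<^sub>R L b)"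
proof -
  have "L x = L (\<Sum>b\<in>Basis. (x \<bullet> b) *\<^sub>R b)"
    by (simp add: euclidean_representation)
  then show ?thesis
    using assms by (simp add: linear_sum linear_cmul del: euclidean_representation_sum euclidean_representation)
qed

text \<open>Chain rule: a derivative of the composite is a combination of the partial derivatives of the
  outer map, to which the induction hypothesis applies, with coefficients from the inner map.\<close>

lemma times_differentiable_compose:
  fixes f :: "'d::euclidean_space \<Rightarrow> 'e::euclidean_space"
  assumes "open S" "f ` S \<subseteq> T"
    and "times_differentiable_on k f S" "times_differentiable_on k g T"
  shows "times_differentiable_on k (\<lambda>x. g (f x)) S"
  using assms(3-)
proof (induction k arbitrary: g)
  case 0
  then show ?case using assms(2) by (auto intro: continuous_on_compose2)
next
  case (Suc k)
  let ?f' = "\<lambda>x. frechet_derivative f (at x)" and ?g' = "\<lambda>x. frechet_derivative g (at x)"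
  have g': "(g has_derivative ?g' (f x)) (at (f x))" if "x \<in> S" for x
    using times_differentiable_Suc_derivative[OF Suc.prems(2)] assms(2) that by auto
  have D: "((\<lambda>x. g (f x)) has_derivative (\<lambda>e. \<Sum>b\<in>Basis. (?f' x e \<bullet> b) *\<^sub>R ?g' (f x) b)) (at x)"
    if "x \<in> S" for x
  proof -
    have "linear (?g' (f x))"
      using g'[OF that] by (rule has_derivative_linear)
    then have eq: "(\<Sum>b\<in>Basis. (y \<bullet> b) *\<^sub>R ?g' (f x) b) = ?g' (f x) y" for y
      by (rule linear_basis_expansion[symmetric])
    show ?thesis
      unfolding eq
      by (rule has_derivative_compose[OF times_differentiable_Suc_derivative[OF Suc.prems(1) that]
            g'[OF that]])
  qed
  show ?case
  proof (rule times_differentiableI[OF assms(1) D])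
    fix e
    show "times_differentiable_on k (\<lambda>x. \<Sum>b\<in>Basis. (?f' x e \<bullet> b) *\<^sub>R ?g' (f x) b) S"
      using Suc.prems times_differentiable_SucD[OF Suc.prems(1)]
      by (intro times_differentiable_sum times_differentiable_scaleR assms(1) Suc.IH
          times_differentiable_bounded_linear[of "\<lambda>x. x \<bullet> _"] bounded_linear_inner_left) auto
  qed auto
qed

lemma smooth_on_subset: "smooth_on f T \<Longrightarrow> S \<subseteq> T \<Longrightarrow> smooth_on f S"
  by (auto simp: smooth_on_def intro: times_differentiable_subset)

lemma smooth_on_cong: "open S \<Longrightarrow> smooth_on f S \<Longrightarrow> (\<And>x. x \<in> S \<Longrightarrow> f x = g x) \<Longrightarrow> smooth_on g S"
  unfolding smooth_on_def using times_differentiable_cong[of S f g] by simp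

lemma smooth_on_local:
  "(\<And>x. x \<in> S \<Longrightarrow> \<exists>U. open U \<and> x \<in> U \<and> smooth_on f U) \<Longrightarrow> smooth_on f S"
  unfolding smooth_on_def by (meson times_differentiable_local)

lemma smooth_on_const: "smooth_on (\<lambda>x. c) S"
  by (simp add: smooth_on_def times_differentiable_const)

lemma smooth_on_bounded_linear_compose:
  "bounded_linear L \<Longrightarrow> open S \<Longrightarrow> smooth_on f S \<Longrightarrow> smooth_on (\<lambda>x. L (f x)) S"
  by (simp add: smooth_on_def times_differentiable_bounded_linear)

lemma smooth_on_add:
  "open S \<Longrightarrow> smooth_on f S \<Longrightarrow> smooth_on g S \<Longrightarrow> smooth_on (\<lambda>x. f x + g x) S"
  by (simp add: smooth_on_def times_differentiable_add)

lemma smooth_on_sum: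
  "open S \<Longrightarrow> (\<And>i. i \<in> I \<Longrightarrow> smooth_on (f i) S) \<Longrightarrow> smooth_on (\<lambda>x. \<Sum>i\<in>I. f i x) S"
  by (simp add: smooth_on_def times_differentiable_sum)

lemma smooth_on_scaleR:
  "open S \<Longrightarrow> smooth_on f S \<Longrightarrow> smooth_on g S \<Longrightarrow> smooth_on (\<lambda>x. f x *\<^sub>R g x) S"
  by (simp add: smooth_on_def times_differentiable_scaleR)

lemma smooth_on_mult:
  fixes f g :: "'e::euclidean_space \<Rightarrow> real"
  shows "open S \<Longrightarrow> smooth_on f S \<Longrightarrow> smooth_on g S \<Longrightarrow> smooth_on (\<lambda>x. f x * g x) S"
  using smooth_on_scaleR[of S f g] by simp

lemma smooth_on_compose:
  fixes f :: "'d::euclidean_space \<Rightarrow> 'e::euclidean_space"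
  shows "open S \<Longrightarrow> f ` S \<subseteq> T \<Longrightarrow> smooth_on f S \<Longrightarrow> smooth_on g T \<Longrightarrow> smooth_on (\<lambda>x. g (f x)) S"
  by (simp add: smooth_on_def times_differentiable_compose)

lemma smooth_on_directional_derivative:
  "smooth_on f S \<Longrightarrow> smooth_on (\<lambda>x. frechet_derivative f (at x) e) S"
  unfolding smooth_on_def by (metis times_differentiable_on.simps(2))

lemma smooth_on_has_derivative:
  "smooth_on f S \<Longrightarrow> x \<in> S \<Longrightarrow> (f has_derivative frechet_derivative f (at x)) (at x)"
  unfolding smooth_on_def by (blast intro: times_differentiable_Suc_derivative)

lemma smooth_on_imp_continuous_on: "smooth_on f S \<Longrightarrow> continuous_on S f"
  unfolding smooth_on_def by (metis times_differentiable_on.simps(1))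

lemma smooth_on_ident: "smooth_on (\<lambda>x. x) S"
proof -
  have "times_differentiable_on k (\<lambda>x. x) S" for k
    by (cases k) (auto simp: frechet_derivative_ident times_differentiable_const intro: continuous_on_id)
  then show ?thesis by (simp add: smooth_on_def)
qed

lemma smooth_on_bounded_linear: "bounded_linear L \<Longrightarrow> smooth_on L S"
  using smooth_on_bounded_linear_compose[OF _ open_UNIV smooth_on_ident] smooth_on_subset
  by blast

lemma smooth_on_Pair:
  assumes "open S" "smooth_on f S" "smooth_on g S"
  shows "smooth_on (\<lambda>x. (f x, g x)) S"
proof -
  have "smooth_on (\<lambda>x. (f x, 0) + (0, g x)) S"
    by (intro smooth_on_add smooth_on_bounded_linear_compose[of "\<lambda>y. (y, 0)"]
        smooth_on_bounded_linear_compose[of "\<lambda>y. (0, y)"] bounded_linear_Pair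
        bounded_linear_ident bounded_linear_zero assms)
  then show ?thesis by simp
qed

lemma smooth_on_vec_lambda:
  assumes "open S" "\<And>i. smooth_on (\<lambda>x. f x i) S"
  shows "smooth_on (\<lambda>x. (\<chi> i. f x i) :: real^'n) S"
proof -
  have "smooth_on (\<lambda>x. \<Sum>i\<in>UNIV. f x i *\<^sub>R (axis i 1 :: real^'n)) S"
    by (intro smooth_on_sum smooth_on_scaleR smooth_on_const assms)
  moreover have "(\<Sum>i\<in>UNIV. f x i *\<^sub>R (axis i 1 :: real^'n)) = (\<chi> i. f x i)" for x
    by (vector axis_def) (simp add: if_distrib cong: if_cong)
  ultimately show ?thesis by simp
qed

lemma segment_in_ball:
  fixes a x :: "'e::euclidean_space"
  assumes "x \<in> ball a r" "t \<in> {0..1}"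
  shows "a + t *\<^sub>R (x - a) \<in> ball a r"
proof -
  have "\<bar>t\<bar> * norm (x - a) \<le> norm (x - a)"
    using assms by (intro mult_left_le_one_le) auto
  then show ?thesis using assms by (auto simp: dist_norm norm_minus_commute)
qed

text \<open>Differentiation under the integral sign. The power of \<open>t\<close> makes the class of integrals closed
  under differentiation: by the chain rule, each derivative contributes one more factor \<open>t\<close>.\<close>

lemma has_derivative_radial_mean:
  fixes G :: "'e::euclidean_space \<Rightarrow> real"
  assumes "smooth_on G (ball a r)" "x \<in> ball a r"
  shows "((\<lambda>x. integral {0..1} (\<lambda>t. t ^ m * G (a + t *\<^sub>R (x - a)))) has_derivative
    (\<lambda>e. integral {0..1} (\<lambda>t. t ^ Suc m * frechet_derivative G (at (a + t *\<^sub>R (x - a))) e))) (at x)"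
proof -
  let ?\<gamma> = "\<lambda>x t::real. a + t *\<^sub>R (x - a)"
  let ?G' = "\<lambda>z. frechet_derivative G (at z)"
  note in_ball = segment_in_ball[where a = a and r = r]
  have G': "(G has_derivative ?G' z) (at z)" if "z \<in> ball a r" for z
    by (rule smooth_on_has_derivative[OF assms(1) that])
  have bl: "blinfun_apply (Blinfun (?G' z)) = ?G' z" if "z \<in> ball a r" for z
    using G'[OF that] by (intro bounded_linear_Blinfun_apply has_derivative_bounded_linear)
  define D where "D = (\<lambda>x t. t ^ Suc m *\<^sub>R Blinfun (?G' (?\<gamma> x t)))"
  have cont\<gamma>: "continuous_on (ball a r \<times> cbox 0 1) (\<lambda>(x, t). ?\<gamma> x t)"
    by (auto simp: case_prod_beta intro!: continuous_intros)
  have cont: "continuous_on (ball a r \<times> cbox 0 1) (\<lambda>(x, t). D x t)"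
  proof (rule continuous_on_blinfun_componentwise)
    fix i :: 'e
    have "continuous_on (ball a r \<times> cbox 0 1) (\<lambda>z. ?G' (case z of (x, t) \<Rightarrow> ?\<gamma> x t) i)"
      by (rule continuous_on_compose2[OF smooth_on_imp_continuous_on[OF
              smooth_on_directional_derivative[OF assms(1)]] cont\<gamma>])
        (use in_ball in auto)
    then have "continuous_on (ball a r \<times> cbox 0 1)
        (\<lambda>z. snd z ^ Suc m * ?G' (case z of (x, t) \<Rightarrow> ?\<gamma> x t) i)"
      by (intro continuous_intros)
    then show "continuous_on (ball a r \<times> cbox 0 1) (\<lambda>z. (case z of (x, t) \<Rightarrow> D x t) i)"
      by (rule continuous_on_eq) (use bl in_ball in \<open>auto simp: D_def scaleR_blinfun.rep_eq\<close>)
  qed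
  have "((\<lambda>x. integral (cbox 0 1) (\<lambda>t. t ^ m * G (?\<gamma> x t))) has_derivative
      blinfun_apply (integral (cbox 0 1) (D x))) (at x within ball a r)"
  proof (rule leibniz_rule[OF _ _ cont assms(2)])
    fix x and t :: real
    assume *: "x \<in> ball a r" "t \<in> cbox 0 1"
    have \<gamma>: "?\<gamma> x t \<in> ball a r" using in_ball * by auto
    have "linear (?G' (?\<gamma> x t))" using G'[OF \<gamma>] by (rule has_derivative_linear)
    then have D: "blinfun_apply (D x t) = (\<lambda>e. t ^ m * ?G' (?\<gamma> x t) (t *\<^sub>R e))"
      by (auto simp: D_def scaleR_blinfun.rep_eq bl[OF \<gamma>] linear_cmul)
    have "((\<lambda>x. ?\<gamma> x t) has_derivative (\<lambda>e. t *\<^sub>R e)) (at x)"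
      by (auto intro!: derivative_eq_intros)
    then have "((\<lambda>x. G (?\<gamma> x t)) has_derivative (\<lambda>e. ?G' (?\<gamma> x t) (t *\<^sub>R e))) (at x)"
      using G'[OF \<gamma>] by (rule has_derivative_compose)
    then have "((\<lambda>x. t ^ m * G (?\<gamma> x t)) has_derivative D x t) (at x)"
      unfolding D by (rule has_derivative_mult_right)
    then show "((\<lambda>x. t ^ m * G (?\<gamma> x t)) has_derivative D x t) (at x within ball a r)"
      by (rule has_derivative_at_withinI)
  next
    fix x assume x: "x \<in> ball a r"
    have "continuous_on (cbox 0 1) (\<lambda>t. G (?\<gamma> x t))"
      by (rule continuous_on_compose2[OF smooth_on_imp_continuous_on[OF assms(1)]])
        (use in_ball x in \<open>auto intro!: continuous_intros\<close>)
    then show "(\<lambda>t. t ^ m * G (?\<gamma> x t)) integrable_on cbox 0 1"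
      by (intro integrable_continuous continuous_intros)
  qed auto
  moreover have eq: "blinfun_apply (integral (cbox 0 1) (D x)) e
      = integral {0..1} (\<lambda>t. t ^ Suc m * ?G' (?\<gamma> x t) e)" for e
  proof -
    have "continuous_on (cbox 0 1) (D x)"
      using continuous_on_compose2[OF cont, of "cbox 0 1" "\<lambda>t. (x, t)"] assms(2)
      by (fastforce intro!: continuous_intros)
    then have "blinfun_apply (integral (cbox 0 1) (D x)) e = integral (cbox 0 1) (\<lambda>t. D x t e)"
      by (intro blinfun_apply_integral integrable_continuous)
    also have "\<dots> = integral {0..1} (\<lambda>t. t ^ Suc m * ?G' (?\<gamma> x t) e)"
      unfolding cbox_interval
      by (rule integral_cong) (use bl in_ball assms(2) in \<open>auto simp: D_def scaleR_blinfun.rep_eq\<close>)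
    finally show ?thesis .
  qed
  ultimately show ?thesis
    unfolding ext[OF eq] at_within_open[OF assms(2) open_ball] unfolding cbox_interval by simp
qed

text \<open>The case \<open>m = 0\<close> is the one of interest; the induction on \<open>k\<close> passes from \<open>m\<close> to \<open>m + 1\<close>.\<close>

lemma times_differentiable_radial_mean:
  fixes G :: "'e::euclidean_space \<Rightarrow> real"
  assumes "smooth_on G (ball a r)"
  shows "times_differentiable_on k (\<lambda>x. integral {0..1} (\<lambda>t. t ^ m * G (a + t *\<^sub>R (x - a)))) (ball a r)"
  using assms
proof (induction k arbitrary: G m)
  case 0
  then show ?case
    by (auto intro!: continuous_at_imp_continuous_on
        has_derivative_continuous[OF has_derivative_radial_mean])
next
  case (Suc k)
  show ?case
    by (rule times_differentiableI[OF open_ball has_derivative_radial_mean[OF Suc.prems]])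
      (assumption, rule Suc.IH[OF smooth_on_directional_derivative[OF Suc.prems]])
qed

text \<open>Hadamard's lemma: integrate the derivative of \<open>f\<close> along the segment from \<open>a\<close> to \<open>x\<close>.\<close>

lemma hadamard:
  fixes f :: "'e::euclidean_space \<Rightarrow> real"
  assumes "smooth_on f (ball a r)" "r > 0"
  obtains g where "\<And>b. smooth_on (g b) (ball a r)"
    and "\<And>b. g b a = frechet_derivative f (at a) b"
    and "\<And>x. x \<in> ball a r \<Longrightarrow> f x = f a + (\<Sum>b\<in>Basis. ((x - a) \<bullet> b) * g b x)"
proof
  let ?f' = "\<lambda>z. frechet_derivative f (at z)"
  let ?g = "\<lambda>b x. integral {0..1} (\<lambda>t. ?f' (a + t *\<^sub>R (x - a)) b)"
  show "smooth_on (?g b) (ball a r)" for b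
    unfolding smooth_on_def
    using times_differentiable_radial_mean[OF smooth_on_directional_derivative[OF assms(1)], of _ 0 b]
    by simp
  show "?g b a = ?f' a b" for b
    by simp
  show "f x = f a + (\<Sum>b\<in>Basis. ((x - a) \<bullet> b) * ?g b x)" if x: "x \<in> ball a r" for x
  proof -
    let ?\<gamma> = "\<lambda>t. a + t *\<^sub>R (x - a)"
    note in_ball = segment_in_ball[OF x]
    have f': "(f has_derivative ?f' (?\<gamma> t)) (at (?\<gamma> t))" if "t \<in> {0..1}" for t
      by (rule smooth_on_has_derivative[OF assms(1) in_ball[OF that]])
    have lin: "linear (?f' (?\<gamma> t))" if "t \<in> {0..1}" for t
      using f'[OF that] by (rule has_derivative_linear)
    have int: "((\<lambda>t. ?f' (?\<gamma> t) (x - a)) has_integral (f (?\<gamma> 1) - f (?\<gamma> 0))) {0..1}"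
    proof (rule fundamental_theorem_of_calculus)
      fix t :: real assume t: "t \<in> {0..1}"
      have "(?\<gamma> has_derivative (\<lambda>s. s *\<^sub>R (x - a))) (at t)"
        by (auto intro!: derivative_eq_intros)
      then have "((\<lambda>t. f (?\<gamma> t)) has_derivative (\<lambda>s. ?f' (?\<gamma> t) (s *\<^sub>R (x - a)))) (at t)"
        using f'[OF t] by (rule has_derivative_compose)
      then show "((\<lambda>t. f (?\<gamma> t)) has_vector_derivative ?f' (?\<gamma> t) (x - a)) (at t within {0..1})"
        using lin[OF t] by (simp add: has_vector_derivative_def linear_cmul has_derivative_at_withinI)
    qed auto
    have "(\<lambda>t. ?f' (?\<gamma> t) b) integrable_on {0..1}" for b
      by (intro integrable_continuous_interval continuous_on_compose2[OF
            smooth_on_imp_continuous_on[OF smooth_on_directional_derivative[OF assms(1)]]]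
          continuous_intros) (use in_ball in auto)
    then have "((\<lambda>t. \<Sum>b\<in>Basis. ((x - a) \<bullet> b) * ?f' (?\<gamma> t) b) has_integral
        (\<Sum>b\<in>Basis. ((x - a) \<bullet> b) * ?g b x)) {0..1}"
      by (intro has_integral_sum has_integral_mult_right integrable_integral) auto
    then have "((\<lambda>t. ?f' (?\<gamma> t) (x - a)) has_integral (\<Sum>b\<in>Basis. ((x - a) \<bullet> b) * ?g b x)) {0..1}"
      by (rule has_integral_eq[rotated])
        (use linear_basis_expansion[OF lin, of _ "x - a"] in auto)
    from has_integral_unique[OF int this] show ?thesis by simp
  qed
qed

section \<open>Smooth functions on a manifold\<close>

locale smooth_atlas_space =
  fixes A :: "('p, 'e::euclidean_space) atlas"
  assumes atlas: "smooth_atlas A"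
begin

lemma chart_inj: "(U, \<phi>) \<in> A \<Longrightarrow> inj_on \<phi> U"
  using atlas by (auto simp: smooth_atlas_def)

lemma chart_inv [simp]: "(U, \<phi>) \<in> A \<Longrightarrow> p \<in> U \<Longrightarrow> inv_into U \<phi> (\<phi> p) = p"
  by (simp add: chart_inj)

lemma chart_domain_subset: "(U, \<phi>) \<in> A \<Longrightarrow> U \<subseteq> points A"
  by (force simp: points_def)

lemma chart_around:
  assumes "p \<in> points A"
  obtains U \<phi> where "(U, \<phi>) \<in> A" "p \<in> U"
  using assms by (force simp: points_def)

lemma transition:
  assumes "(U, \<phi>) \<in> A" "(V, \<psi>) \<in> A"
  shows "open (\<phi> ` (U \<inter> V))" "smooth_on (\<psi> \<circ> inv_into U \<phi>) (\<phi> ` (U \<inter> V))"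
  using atlas assms unfolding smooth_atlas_def by fast+

lemma openin_atlas_iff:
  "openin (atlas_topology A) W \<longleftrightarrow> W \<subseteq> points A \<and> (\<forall>(U, \<phi>)\<in>A. open (\<phi> ` (U \<inter> W)))"
proof -
  have "istopology (\<lambda>W. W \<subseteq> points A \<and> (\<forall>(U, \<phi>)\<in>A. open (\<phi> ` (U \<inter> W))))"
    unfolding istopology_def
  proof (intro conjI allI impI)
    fix W W' assume W: "W \<subseteq> points A \<and> (\<forall>(U, \<phi>)\<in>A. open (\<phi> ` (U \<inter> W)))"
      "W' \<subseteq> points A \<and> (\<forall>(U, \<phi>)\<in>A. open (\<phi> ` (U \<inter> W')))"
    show "W \<inter> W' \<subseteq> points A" using W by blast
    show "\<forall>(U, \<phi>)\<in>A. open (\<phi> ` (U \<inter> (W \<inter> W')))"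
    proof clarify
      fix U \<phi> assume c: "(U, \<phi>) \<in> A"
      have "\<phi> ` (U \<inter> (W \<inter> W')) = \<phi> ` ((U \<inter> W) \<inter> (U \<inter> W'))"
        by (intro arg_cong[where f = "image \<phi>"]) blast
      also have "\<dots> = \<phi> ` (U \<inter> W) \<inter> \<phi> ` (U \<inter> W')"
        by (rule inj_on_image_Int[OF chart_inj[OF c]]) auto
      finally show "open (\<phi> ` (U \<inter> (W \<inter> W')))"
        using W c by (auto intro!: open_Int)
    qed
  next
    fix K assume K: "\<forall>W\<in>K. W \<subseteq> points A \<and> (\<forall>(U, \<phi>)\<in>A. open (\<phi> ` (U \<inter> W)))"
    show "\<Union> K \<subseteq> points A" using K by blast
    show "\<forall>(U, \<phi>)\<in>A. open (\<phi> ` (U \<inter> \<Union> K))"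
    proof clarify
      fix U \<phi> assume "(U, \<phi>) \<in> A"
      moreover have "\<phi> ` (U \<inter> \<Union> K) = (\<Union>W\<in>K. \<phi> ` (U \<inter> W))" by blast
      moreover have "open (\<phi> ` (U \<inter> W))" if "W \<in> K" for W
        using K that \<open>(U, \<phi>) \<in> A\<close> by blast
      ultimately show "open (\<phi> ` (U \<inter> \<Union> K))" by (simp add: open_UN)
    qed
  qed
  then show ?thesis
    by (simp add: atlas_topology_def topology_inverse')
qed

lemma chart_image_open:
  "(U, \<phi>) \<in> A \<Longrightarrow> openin (atlas_topology A) W \<Longrightarrow> open (\<phi> ` (U \<inter> W))"
  by (auto simp: openin_atlas_iff)

lemma chart_preimage_open:
  assumes c: "(U, \<phi>) \<in> A" and O: "open O'"
  shows "openin (atlas_topology A) {p \<in> U. \<phi> p \<in> O'}"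
  unfolding openin_atlas_iff
proof (intro conjI ballI, safe)
  show "p \<in> U \<Longrightarrow> p \<in> points A" for p using chart_domain_subset[OF c] by blast
  fix V \<psi> assume d: "(V, \<psi>) \<in> A"
  note t = transition[OF d c]
  have "\<psi> ` (V \<inter> {p \<in> U. \<phi> p \<in> O'}) = \<psi> ` (V \<inter> U) \<inter> (\<phi> \<circ> inv_into V \<psi>) -` O'"
    using d by auto
  then show "open (\<psi> ` (V \<inter> {p \<in> U. \<phi> p \<in> O'}))"
    using continuous_open_preimage[OF smooth_on_imp_continuous_on[OF t(2)] t(1) O] by simp
qed

lemma chart_domain_open: "(U, \<phi>) \<in> A \<Longrightarrow> openin (atlas_topology A) U"
  using chart_preimage_open[of U \<phi> UNIV] by simp

lemma openin_points: "openin (atlas_topology A) (points A)"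
  unfolding openin_atlas_iff
proof (intro conjI ballI, safe)
  fix U \<phi> assume c: "(U, \<phi>) \<in> A"
  then have "U \<inter> points A = U \<inter> U" using chart_domain_subset by blast
  then show "open (\<phi> ` (U \<inter> points A))" using transition(1)[OF c c] by simp
qed

lemma openin_subset_points: "openin (atlas_topology A) W \<Longrightarrow> W \<subseteq> points A"
  by (simp add: openin_atlas_iff)

lemma smooth_fun_onD:
  "smooth_fun_on A W f \<Longrightarrow> (U, \<phi>) \<in> A \<Longrightarrow> smooth_on (f \<circ> inv_into U \<phi>) (\<phi> ` (U \<inter> W))"
  by (auto simp: smooth_fun_on_def)

lemma smooth_fun_onI:
  "(\<And>U \<phi>. (U, \<phi>) \<in> A \<Longrightarrow> smooth_on (f \<circ> inv_into U \<phi>) (\<phi> ` (U \<inter> W))) \<Longrightarrow> smooth_fun_on A W f"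
  by (auto simp: smooth_fun_on_def)

lemma smooth_fun_on_subset: "smooth_fun_on A W f \<Longrightarrow> W' \<subseteq> W \<Longrightarrow> smooth_fun_on A W' f"
  unfolding smooth_fun_on_def by (fastforce intro: smooth_on_subset)

lemma smooth_fun_on_cong:
  assumes "openin (atlas_topology A) W" "\<And>p. p \<in> W \<Longrightarrow> f p = g p" "smooth_fun_on A W f"
  shows "smooth_fun_on A W g"
proof (rule smooth_fun_onI)
  fix U \<phi> assume c: "(U, \<phi>) \<in> A"
  show "smooth_on (g \<circ> inv_into U \<phi>) (\<phi> ` (U \<inter> W))"
    by (rule smooth_on_cong[OF chart_image_open[OF c assms(1)] smooth_fun_onD[OF assms(3) c]])
      (use c assms(2) in auto)
qed

lemma smooth_fun_on_const: "smooth_fun_on A W (\<lambda>p. a)"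
  by (simp add: smooth_fun_on_def o_def smooth_on_const)

lemma smooth_fun_on_add:
  assumes "openin (atlas_topology A) W" "smooth_fun_on A W f" "smooth_fun_on A W g"
  shows "smooth_fun_on A W (\<lambda>p. f p + g p)"
proof (rule smooth_fun_onI)
  fix U \<phi> assume c: "(U, \<phi>) \<in> A"
  show "smooth_on ((\<lambda>p. f p + g p) \<circ> inv_into U \<phi>) (\<phi> ` (U \<inter> W))"
    using smooth_on_add[OF chart_image_open[OF c assms(1)] smooth_fun_onD[OF assms(2) c]
        smooth_fun_onD[OF assms(3) c]] by (simp add: o_def)
qed

lemma smooth_fun_on_mult:
  assumes "openin (atlas_topology A) W" "smooth_fun_on A W f" "smooth_fun_on A W g"
  shows "smooth_fun_on A W (\<lambda>p. f p * g p)"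
proof (rule smooth_fun_onI)
  fix U \<phi> assume c: "(U, \<phi>) \<in> A"
  show "smooth_on ((\<lambda>p. f p * g p) \<circ> inv_into U \<phi>) (\<phi> ` (U \<inter> W))"
    using smooth_on_mult[OF chart_image_open[OF c assms(1)] smooth_fun_onD[OF assms(2) c]
        smooth_fun_onD[OF assms(3) c]] by (simp add: o_def)
qed

lemma smooth_fun_on_local:
  assumes "\<And>p. p \<in> W \<Longrightarrow> \<exists>W'. openin (atlas_topology A) W' \<and> p \<in> W' \<and> smooth_fun_on A W' f"
  shows "smooth_fun_on A W f"
proof (rule smooth_fun_onI, rule smooth_on_local)
  fix U \<phi> z assume c: "(U, \<phi>) \<in> A" and "z \<in> \<phi> ` (U \<inter> W)"
  then obtain p where p: "p \<in> U" "p \<in> W" "z = \<phi> p" by blast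
  with assms obtain W' where "openin (atlas_topology A) W'" "p \<in> W'" "smooth_fun_on A W' f" by blast
  with c p show "\<exists>O'. open O' \<and> z \<in> O' \<and> smooth_on (f \<circ> inv_into U \<phi>) O'"
    by (intro exI[of _ "\<phi> ` (U \<inter> W')"]) (auto intro: chart_image_open smooth_fun_onD)
qed

text \<open>One chart suffices to test smoothness, because the transition maps are smooth.\<close>

lemma smooth_fun_on_chart:
  assumes c: "(U, \<phi>) \<in> A" and W: "openin (atlas_topology A) W" "W \<subseteq> U"
    and f: "smooth_on (f \<circ> inv_into U \<phi>) (\<phi> ` W)"
  shows "smooth_fun_on A W f"
proof (rule smooth_fun_onI)
  fix V \<psi> assume d: "(V, \<psi>) \<in> A"
  have op: "open (\<psi> ` (V \<inter> W))" by (rule chart_image_open[OF d W(1)])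
  have "smooth_on (\<lambda>z. (f \<circ> inv_into U \<phi>) ((\<phi> \<circ> inv_into V \<psi>) z)) (\<psi> ` (V \<inter> W))"
  proof (rule smooth_on_compose[OF op _ _ f])
    show "(\<phi> \<circ> inv_into V \<psi>) ` \<psi> ` (V \<inter> W) \<subseteq> \<phi> ` W" using d by auto
    show "smooth_on (\<phi> \<circ> inv_into V \<psi>) (\<psi> ` (V \<inter> W))"
      by (rule smooth_on_subset[OF transition(2)[OF d c]]) (use W in blast)
  qed
  then show "smooth_on (f \<circ> inv_into V \<psi>) (\<psi> ` (V \<inter> W))"
    by (rule smooth_on_cong[OF op]) (use W c d in auto)
qed

lemma smooth_fun_on_coordinate:
  fixes L :: "'e \<Rightarrow> real"
  assumes c: "(U, \<phi>) \<in> A" and L: "bounded_linear L"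
  shows "smooth_fun_on A U (\<lambda>p. L (\<phi> p))"
proof (rule smooth_fun_on_chart[OF c chart_domain_open[OF c] order_refl])
  have "open (\<phi> ` U)" using transition(1)[OF c c] by simp
  then show "smooth_on ((\<lambda>p. L (\<phi> p)) \<circ> inv_into U \<phi>) (\<phi> ` U)"
    by (rule smooth_on_cong[OF _ smooth_on_bounded_linear[OF L]]) (auto simp: f_inv_into_f)
qed

text \<open>Tangent vectors refer to smoothness near a point, vector fields to smoothness on open sets; this
  translates between the two.\<close>

lemma smooth_near_iff:
  assumes "openin (atlas_topology A) W"
  shows "smooth_fun_on A W f \<longleftrightarrow> (\<forall>p\<in>W. smooth_near A p f)"
  using assms smooth_fun_on_local[of W f] unfolding smooth_near_def by blast

lemma smooth_near_in_points: "smooth_near A p f \<Longrightarrow> p \<in> points A"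
  using openin_subset_points by (auto simp: smooth_near_def)

lemma smooth_near_open:
  assumes "smooth_near A p f"
  obtains W where "openin (atlas_topology A) W" "p \<in> W" "\<And>q. q \<in> W \<Longrightarrow> smooth_near A q f"
  using assms unfolding smooth_near_def by blast

lemma smooth_near_cong:
  assumes "openin (atlas_topology A) W" "p \<in> W" "\<And>q. q \<in> W \<Longrightarrow> f q = g q" "smooth_near A p f"
  shows "smooth_near A p g"
proof -
  from assms(4) obtain W' where W': "openin (atlas_topology A) W'" "p \<in> W'" "smooth_fun_on A W' f"
    by (auto simp: smooth_near_def)
  have "smooth_fun_on A (W \<inter> W') g"
    using assms(1,3) W' smooth_fun_on_cong[of "W \<inter> W'" f g] smooth_fun_on_subset[of W' f "W \<inter> W'"]
    by auto
  then show ?thesis using assms(1,2) W' by (auto simp: smooth_near_def)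
qed

lemma smooth_near_const: "p \<in> points A \<Longrightarrow> smooth_near A p (\<lambda>q. a)"
  using openin_points smooth_fun_on_const by (auto simp: smooth_near_def)

lemma smooth_near_common:
  assumes "smooth_near A p f" "smooth_near A p g"
  obtains W where "openin (atlas_topology A) W" "p \<in> W" "smooth_fun_on A W f" "smooth_fun_on A W g"
    "\<And>q. q \<in> W \<Longrightarrow> smooth_near A q f" "\<And>q. q \<in> W \<Longrightarrow> smooth_near A q g"
proof -
  from assms obtain W W' where "openin (atlas_topology A) W" "p \<in> W" "smooth_fun_on A W f"
    "openin (atlas_topology A) W'" "p \<in> W'" "smooth_fun_on A W' g"
    by (auto simp: smooth_near_def)
  then show ?thesis
    by (intro that[of "W \<inter> W'"]) (auto intro: smooth_fun_on_subset simp: smooth_near_def)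
qed

lemma smooth_near_add:
  assumes "smooth_near A p f" "smooth_near A p g"
  shows "smooth_near A p (\<lambda>q. f q + g q)"
proof -
  obtain W where W: "openin (atlas_topology A) W" "p \<in> W" "smooth_fun_on A W f" "smooth_fun_on A W g"
    by (rule smooth_near_common[OF assms])
  from smooth_fun_on_add[OF W(1,3,4)] W(1,2) show ?thesis unfolding smooth_near_def by blast
qed

lemma smooth_near_mult:
  assumes "smooth_near A p f" "smooth_near A p g"
  shows "smooth_near A p (\<lambda>q. f q * g q)"
proof -
  obtain W where W: "openin (atlas_topology A) W" "p \<in> W" "smooth_fun_on A W f" "smooth_fun_on A W g"
    by (rule smooth_near_common[OF assms])
  from smooth_fun_on_mult[OF W(1,3,4)] W(1,2) show ?thesis unfolding smooth_near_def by blast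
qed

lemma smooth_near_scale: "smooth_near A p f \<Longrightarrow> smooth_near A p (\<lambda>q. a * f q)"
  by (intro smooth_near_mult smooth_near_const smooth_near_in_points)

lemma smooth_near_diff:
  "smooth_near A p f \<Longrightarrow> smooth_near A p g \<Longrightarrow> smooth_near A p (\<lambda>q. f q - g q)"
  using smooth_near_add[of p f "\<lambda>q. (-1) * g q"] smooth_near_scale[of p g "-1"] by simp

lemma smooth_near_sum:
  assumes "p \<in> points A" "\<And>i. i \<in> I \<Longrightarrow> smooth_near A p (f i)"
  shows "smooth_near A p (\<lambda>q. \<Sum>i\<in>I. f i q)"
  using assms(2)
  by (induction I rule: infinite_finite_induct)
    (auto intro: smooth_near_const[OF assms(1)] smooth_near_add)

lemma smooth_near_coordinate:
  fixes L :: "'e \<Rightarrow> real"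
  assumes "(U, \<phi>) \<in> A" "bounded_linear L" "p \<in> U"
  shows "smooth_near A p (\<lambda>p. L (\<phi> p))"
  using chart_domain_open[OF assms(1)] smooth_fun_on_coordinate[OF assms(1,2)] assms(3)
  unfolding smooth_near_def by blast

lemma smooth_near_chartI:
  assumes c: "(U, \<phi>) \<in> A" "p \<in> U" and O: "open O'" "\<phi> p \<in> O'" "O' \<subseteq> \<phi> ` U"
    and f: "smooth_on (f \<circ> inv_into U \<phi>) O'"
  shows "smooth_near A p f"
proof -
  have "\<phi> ` {q \<in> U. \<phi> q \<in> O'} = O'" using O by blast
  then have "smooth_fun_on A {q \<in> U. \<phi> q \<in> O'} f"
    using f by (intro smooth_fun_on_chart[OF c(1) chart_preimage_open[OF c(1) O(1)]]) auto
  then show ?thesis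
    using c O(2) chart_preimage_open[OF c(1) O(1)] unfolding smooth_near_def by blast
qed

lemma smooth_near_chartE:
  assumes c: "(U, \<phi>) \<in> A" "p \<in> U" and "smooth_near A p f"
  obtains r where "r > 0" "ball (\<phi> p) r \<subseteq> \<phi> ` U" "smooth_on (f \<circ> inv_into U \<phi>) (ball (\<phi> p) r)"
proof -
  from assms(3) obtain W where W: "openin (atlas_topology A) W" "p \<in> W" "smooth_fun_on A W f"
    by (auto simp: smooth_near_def)
  have "open (\<phi> ` (U \<inter> W))" "\<phi> p \<in> \<phi> ` (U \<inter> W)" using chart_image_open c W by auto
  then obtain r where "r > 0" "ball (\<phi> p) r \<subseteq> \<phi> ` (U \<inter> W)" by (meson openE)
  with smooth_fun_onD[OF W(3) c(1)] show ?thesis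
    by (intro that[of r]) (auto intro: smooth_on_subset)
qed

section \<open>Tangent vectors\<close>

lemma tangent_add:
  "v \<in> tangent_space A p \<Longrightarrow> smooth_near A p f \<Longrightarrow> smooth_near A p g \<Longrightarrow>
    v (\<lambda>q. f q + g q) = v f + v g"
  by (auto simp: tangent_space_def)

lemma tangent_mult:
  "v \<in> tangent_space A p \<Longrightarrow> smooth_near A p f \<Longrightarrow> smooth_near A p g \<Longrightarrow>
    v (\<lambda>q. f q * g q) = v f * g p + f p * v g"
  by (auto simp: tangent_space_def)

lemma tangent_scale:
  "v \<in> tangent_space A p \<Longrightarrow> smooth_near A p f \<Longrightarrow> v (\<lambda>q. a * f q) = a * v f"
  by (auto simp: tangent_space_def)

lemma tangent_not_smooth: "v \<in> tangent_space A p \<Longrightarrow> \<not> smooth_near A p f \<Longrightarrow> v f = 0"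
  by (auto simp: tangent_space_def)

lemma tangent_diff:
  "v \<in> tangent_space A p \<Longrightarrow> smooth_near A p f \<Longrightarrow> smooth_near A p g \<Longrightarrow>
    v (\<lambda>q. f q - g q) = v f - v g"
  using tangent_add[of v p f "\<lambda>q. (-1) * g q"] smooth_near_scale[of p g "-1"]
    tangent_scale[of v p g "-1"] by simp

lemma tangent_const:
  assumes "v \<in> tangent_space A p" "p \<in> points A"
  shows "v (\<lambda>q. a) = 0"
proof -
  have "v (\<lambda>q. 1) = 0"
    using tangent_mult[OF assms(1) smooth_near_const[OF assms(2), of 1]
        smooth_near_const[OF assms(2), of 1]] by simp
  then show ?thesis
    using tangent_scale[OF assms(1) smooth_near_const[OF assms(2), of 1], of a] by simp
qed

lemma tangent_sum:
  assumes "v \<in> tangent_space A p" "p \<in> points A" "\<And>i. i \<in> I \<Longrightarrow> smooth_near A p (f i)"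
  shows "v (\<lambda>q. \<Sum>i\<in>I. f i q) = (\<Sum>i\<in>I. v (f i))"
  using assms(3)
  by (induction I rule: infinite_finite_induct)
    (auto simp: tangent_const[OF assms(1,2)] tangent_add[OF assms(1)] smooth_near_sum[OF assms(2)])

text \<open>Locality. The indicator function \<open>I\<close> of a neighbourhood of \<open>p\<close> is smooth near \<open>p\<close>, and
  \<open>I\<^sup>2 = I\<close> forces \<open>v I = 0\<close>; hence \<open>v (I f) = v f\<close>.\<close>

lemma tangent_cong:
  assumes v: "v \<in> tangent_space A p" and W: "openin (atlas_topology A) W" "p \<in> W"
    and eq: "\<And>q. q \<in> W \<Longrightarrow> f q = g q"
  shows "v f = v g"
proof (cases "smooth_near A p f")
  case True
  then have g: "smooth_near A p g" using smooth_near_cong[OF W, of f g] eq by blast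
  define I :: "'p \<Rightarrow> real" where "I = (\<lambda>q. if q \<in> W then 1 else 0)"
  have p: "p \<in> points A" using True by (rule smooth_near_in_points)
  have I: "smooth_near A p I"
    by (rule smooth_near_cong[OF W _ smooth_near_const[OF p, of 1]]) (simp add: I_def)
  have "(\<lambda>q. I q * I q) = I" by (auto simp: I_def)
  then have I0: "v I = 0" using tangent_mult[OF v I I] W(2) by (simp add: I_def)
  have "(\<lambda>q. I q * f q) = (\<lambda>q. I q * g q)" using eq by (auto simp: I_def)
  then show ?thesis
    using tangent_mult[OF v I True] tangent_mult[OF v I g] I0 W(2) by (simp add: I_def)
next
  case False
  then have "\<not> smooth_near A p g" using smooth_near_cong[OF W, of g f] eq by auto
  then show ?thesis using False v by (simp add: tangent_not_smooth)
qed

text \<open>By Hadamard's lemma, near \<open>p\<close> a smooth function is a constant plus a combination of products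
  of smooth functions whose first factors are the centred coordinates; so a derivation at \<open>p\<close> is
  determined by its values on the coordinates.\<close>

lemma tangent_expansion:
  assumes v: "v \<in> tangent_space A p" and c: "(U, \<phi>) \<in> A" "p \<in> U" and f: "smooth_near A p f"
  shows "v f = (\<Sum>b\<in>Basis. v (\<lambda>q. \<phi> q \<bullet> b) * frechet_derivative (f \<circ> inv_into U \<phi>) (at (\<phi> p)) b)"
proof -
  let ?F = "f \<circ> inv_into U \<phi>"
  let ?x = "\<lambda>b q. \<phi> q \<bullet> b - \<phi> p \<bullet> b"
  have p: "p \<in> points A" using f by (rule smooth_near_in_points)
  obtain r where r: "r > 0" "ball (\<phi> p) r \<subseteq> \<phi> ` U" "smooth_on ?F (ball (\<phi> p) r)"
    using smooth_near_chartE[OF c f] .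
  obtain g where g: "\<And>b. smooth_on (g b) (ball (\<phi> p) r)"
    "\<And>b. g b (\<phi> p) = frechet_derivative ?F (at (\<phi> p)) b"
    "\<And>x. x \<in> ball (\<phi> p) r \<Longrightarrow> ?F x = ?F (\<phi> p) + (\<Sum>b\<in>Basis. ((x - \<phi> p) \<bullet> b) * g b x)"
    by (rule hadamard[OF r(3,1)]) (rule that)
  have sg: "smooth_near A p (\<lambda>q. g b (\<phi> q))" for b
  proof (rule smooth_near_chartI[OF c open_ball _ r(2)])
    show "smooth_on ((\<lambda>q. g b (\<phi> q)) \<circ> inv_into U \<phi>) (ball (\<phi> p) r)"
      by (rule smooth_on_cong[OF open_ball g(1)[of b]]) (use r(2) in \<open>auto simp: f_inv_into_f subset_iff\<close>)
  qed (use r in auto)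
  have sc: "smooth_near A p (\<lambda>q. \<phi> q \<bullet> b)" for b
    by (rule smooth_near_coordinate[OF c(1) bounded_linear_inner_left c(2)])
  have sx: "smooth_near A p (?x b)" for b
    by (intro smooth_near_diff sc smooth_near_const p)
  have vx: "v (?x b) = v (\<lambda>q. \<phi> q \<bullet> b)" for b
    using tangent_diff[OF v sc smooth_near_const[OF p]] tangent_const[OF v p] by simp
  have summand: "smooth_near A p (\<lambda>q. ?x b q * g b (\<phi> q))" for b
    by (intro smooth_near_mult sx sg)
  have "v f = v (\<lambda>q. f p + (\<Sum>b\<in>Basis. ?x b q * g b (\<phi> q)))"
  proof (rule tangent_cong[OF v chart_preimage_open[OF c(1) open_ball[of "\<phi> p" r]]])
    show "f q = f p + (\<Sum>b\<in>Basis. ?x b q * g b (\<phi> q))" if "q \<in> {q \<in> U. \<phi> q \<in> ball (\<phi> p) r}" for q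
      using g(3)[of "\<phi> q"] that c by (simp add: inner_diff_left)
  qed (use c r in auto)
  also have "\<dots> = (\<Sum>b\<in>Basis. v (\<lambda>q. ?x b q * g b (\<phi> q)))"
    by (simp add: tangent_add[OF v] tangent_sum[OF v p] tangent_const[OF v p] smooth_near_const[OF p]
        smooth_near_sum[OF p] summand)
  also have "\<dots> = (\<Sum>b\<in>Basis. v (\<lambda>q. \<phi> q \<bullet> b) * frechet_derivative ?F (at (\<phi> p)) b)"
    by (simp add: tangent_mult[OF v sx sg] vx g(2))
  finally show ?thesis .
qed

lemma tangent_eqI:
  assumes "v \<in> tangent_space A p" "w \<in> tangent_space A p" "(U, \<phi>) \<in> A" "p \<in> U"
    and "\<And>b. b \<in> Basis \<Longrightarrow> v (\<lambda>q. \<phi> q \<bullet> b) = w (\<lambda>q. \<phi> q \<bullet> b)"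
  shows "v = w"
proof
  fix f
  show "v f = w f"
    using assms tangent_expansion[of v p U \<phi> f] tangent_expansion[of w p U \<phi> f]
      tangent_not_smooth[of v p f] tangent_not_smooth[of w p f]
    by (cases "smooth_near A p f") simp_all
qed

lemma tangent_space_linear:
  assumes "v \<in> tangent_space A p" "w \<in> tangent_space A p"
  shows "(\<lambda>f. a * v f + b * w f) \<in> tangent_space A p"
  using assms unfolding tangent_space_def by (auto simp: algebra_simps)

lemma tangent_space_0: "(\<lambda>f. 0) \<in> tangent_space A p"
  by (auto simp: tangent_space_def)

lemma tangent_space_sum:
  assumes "\<And>i. i \<in> I \<Longrightarrow> v i \<in> tangent_space A p"
  shows "(\<lambda>f. \<Sum>i\<in>I. a i * v i f) \<in> tangent_space A p"
  using assms
proof (induction I rule: infinite_finite_induct)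
  case (insert i I)
  then show ?case using tangent_space_linear[of "v i" p _ "a i" 1] by simp
qed (auto simp: tangent_space_0)

lemma chart_has_derivative:
  assumes "(U, \<phi>) \<in> A" "p \<in> U" "smooth_near A p f"
  shows "((f \<circ> inv_into U \<phi>) has_derivative frechet_derivative (f \<circ> inv_into U \<phi>) (at (\<phi> p))) (at (\<phi> p))"
  using smooth_near_chartE[OF assms] smooth_on_has_derivative by (metis centre_in_ball)

lemma coord_vector_tangent:
  assumes c: "(U, \<phi>) \<in> A" "p \<in> U"
  shows "coord_vector A (U, \<phi>) e p \<in> tangent_space A p"
proof -
  note D = chart_has_derivative[OF c]
  have "frechet_derivative ((\<lambda>q. f q + g q) \<circ> inv_into U \<phi>) (at (\<phi> p)) e =
      frechet_derivative (f \<circ> inv_into U \<phi>) (at (\<phi> p)) e + frechet_derivative (g \<circ> inv_into U \<phi>) (at (\<phi> p)) e"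
    if "smooth_near A p f" "smooth_near A p g" for f g
    using frechet_derivative_at[OF has_derivative_add[OF D[OF that(1)] D[OF that(2)]]]
    by (simp add: o_def fun_eq_iff)
  moreover have "frechet_derivative ((\<lambda>q. f q * g q) \<circ> inv_into U \<phi>) (at (\<phi> p)) e =
      frechet_derivative (f \<circ> inv_into U \<phi>) (at (\<phi> p)) e * g p + f p * frechet_derivative (g \<circ> inv_into U \<phi>) (at (\<phi> p)) e"
    if "smooth_near A p f" "smooth_near A p g" for f g
    using fun_cong[OF frechet_derivative_at[OF has_derivative_mult[OF D[OF that(1)] D[OF that(2)]]], of e] c
    by (simp add: o_def algebra_simps)
  moreover have "frechet_derivative ((\<lambda>q. a * f q) \<circ> inv_into U \<phi>) (at (\<phi> p)) e =
      a * frechet_derivative (f \<circ> inv_into U \<phi>) (at (\<phi> p)) e" if "smooth_near A p f" for f and a :: real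
    using frechet_derivative_at[OF has_derivative_mult_right[OF D[OF that], of a]]
    by (simp add: o_def fun_eq_iff)
  ultimately show ?thesis
    by (auto simp: tangent_space_def coord_vector_def smooth_near_add smooth_near_mult smooth_near_scale)
qed

lemma coord_vector_coordinate:
  assumes c: "(U, \<phi>) \<in> A" "p \<in> U"
  shows "coord_vector A (U, \<phi>) e p (\<lambda>q. \<phi> q \<bullet> b) = e \<bullet> b"
proof -
  have "((\<lambda>q. \<phi> q \<bullet> b) \<circ> inv_into U \<phi> has_derivative (\<lambda>e. e \<bullet> b)) (at (\<phi> p))"
  proof (rule has_derivative_transform_within_open[of "\<lambda>z. z \<bullet> b" _ _ _ "\<phi> ` U"])
    show "open (\<phi> ` U)" using transition(1)[OF c(1) c(1)] by simp
  qed (use c in \<open>auto intro!: derivative_eq_intros\<close>)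
  from fun_cong[OF frechet_derivative_at[OF this], of e] show ?thesis
    using smooth_near_coordinate[OF c(1) bounded_linear_inner_left[of b] c(2)]
    by (simp add: coord_vector_def)
qed

lemma coord_vector_smooth:
  assumes c: "(U, \<phi>) \<in> A" "p \<in> U" and f: "smooth_near A p f"
  shows "smooth_near A p (\<lambda>q. coord_vector A (U, \<phi>) e q f)"
proof -
  obtain r where r: "r > 0" "ball (\<phi> p) r \<subseteq> \<phi> ` U" "smooth_on (f \<circ> inv_into U \<phi>) (ball (\<phi> p) r)"
    by (rule smooth_near_chartE[OF c f])
  show ?thesis
  proof (rule smooth_near_chartI[OF c open_ball _ r(2)])
    show "smooth_on ((\<lambda>q. coord_vector A (U, \<phi>) e q f) \<circ> inv_into U \<phi>) (ball (\<phi> p) r)"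
    proof (rule smooth_on_cong[OF open_ball smooth_on_directional_derivative[OF r(3), of e]])
      fix z assume z: "z \<in> ball (\<phi> p) r"
      then obtain q where q: "q \<in> U" "z = \<phi> q" using r(2) by blast
      have "smooth_near A q f"
        by (rule smooth_near_chartI[OF c(1) q(1) open_ball _ r(2) r(3)]) (use z q in simp)
      then show "frechet_derivative (f \<circ> inv_into U \<phi>) (at z) e =
          ((\<lambda>q. coord_vector A (U, \<phi>) e q f) \<circ> inv_into U \<phi>) z"
        using c q by (simp add: coord_vector_def)
    qed
  qed (use r in simp)
qed

section \<open>Vector fields\<close>

lemma vector_fieldI:
  assumes "\<And>p. p \<in> points A \<Longrightarrow> X p \<in> tangent_space A p"
    and "\<And>p. p \<notin> points A \<Longrightarrow> X p = (\<lambda>f. 0)"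
    and "\<And>p f. smooth_near A p f \<Longrightarrow> smooth_near A p (\<lambda>q. X q f)"
  shows "X \<in> vector_fields A"
  using assms by (auto simp: vector_fields_def smooth_near_iff)

lemma vector_field_tangent:
  assumes "X \<in> vector_fields A"
  shows "X p \<in> tangent_space A p"
  using assms by (cases "p \<in> points A") (auto simp: vector_fields_def tangent_space_0)

lemma vector_field_outside: "X \<in> vector_fields A \<Longrightarrow> p \<notin> points A \<Longrightarrow> X p f = 0"
  by (auto simp: vector_fields_def)

lemma vector_field_smooth:
  assumes "X \<in> vector_fields A" "smooth_near A p f"
  shows "smooth_near A p (\<lambda>q. X q f)"
  using assms unfolding vector_fields_def smooth_near_def by blast

lemmas vector_field_cong = tangent_cong[OF vector_field_tangent]
lemmas vector_field_add = tangent_add[OF vector_field_tangent]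
lemmas vector_field_diff = tangent_diff[OF vector_field_tangent]

text \<open>By locality, an identity under a vector field only has to be checked where the functions
  involved are smooth, which is where the rules for derivations hold.\<close>

lemma vector_field_apply_cong:
  assumes "X \<in> vector_fields A" "smooth_near A p f" "smooth_near A p g"
    and "\<And>q. smooth_near A q f \<Longrightarrow> smooth_near A q g \<Longrightarrow> h q = k q"
  shows "X p h = X p k"
  using smooth_near_common[OF assms(2,3)] assms(4) vector_field_cong[OF assms(1)] by metis

lemma vector_field_eq_on_points:
  assumes "X \<in> vector_fields A" "\<And>q. q \<in> points A \<Longrightarrow> f q = g q"
  shows "X p f = X p g"
  using vector_field_cong[OF assms(1) openin_points _ assms(2)] vector_field_outside[OF assms(1)]
  by (cases "p \<in> points A") auto

lemma vf_linear_combination: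
  assumes "X \<in> vector_fields A" "Y \<in> vector_fields A"
  shows "(\<lambda>p f. a * X p f + b * Y p f) \<in> vector_fields A"
  using assms
  by (intro vector_fieldI smooth_near_add[OF smooth_near_scale smooth_near_scale])
    (auto intro: tangent_space_linear vector_field_tangent vector_field_smooth
      simp: vector_field_outside)

lemma vf_add_closed: "X \<in> vector_fields A \<Longrightarrow> Y \<in> vector_fields A \<Longrightarrow> vf_add X Y \<in> vector_fields A"
  using vf_linear_combination[of X Y 1 1] by (simp add: vf_add_def)

lemma vf_diff_closed: "X \<in> vector_fields A \<Longrightarrow> Y \<in> vector_fields A \<Longrightarrow> vf_diff X Y \<in> vector_fields A"
  using vf_linear_combination[of X Y 1 "-1"] by (simp add: vf_diff_def)

lemma vf_scale_closed: "X \<in> vector_fields A \<Longrightarrow> vf_scale (\<lambda>p. a) X \<in> vector_fields A"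
  using vf_linear_combination[of X X a 0] by (simp add: vf_scale_def)

lemma lie_bracket_apply:
  "smooth_near A p f \<Longrightarrow> lie_bracket A X Y p f = X p (\<lambda>q. Y q f) - Y p (\<lambda>q. X q f)"
  by (simp add: lie_bracket_def)

lemma lie_bracket_closed:
  assumes X: "X \<in> vector_fields A" and Y: "Y \<in> vector_fields A"
  shows "lie_bracket A X Y \<in> vector_fields A"
proof (rule vector_fieldI)
  note s = vector_field_smooth[OF X] vector_field_smooth[OF Y]
  \<comment> \<open>The mixed terms \<open>Y f * X g + X f * Y g\<close> are symmetric in \<open>X\<close> and \<open>Y\<close> and cancel in the bracket.\<close>
  have prod: "X p (\<lambda>q. Y q (\<lambda>r. f r * g r)) =
      X p (\<lambda>q. Y q f) * g p + Y p f * X p g + (X p f * Y p g + f p * X p (\<lambda>q. Y q g))"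
    if XY: "X \<in> vector_fields A" "Y \<in> vector_fields A" and fg: "smooth_near A p f" "smooth_near A p g"
    for X Y p f g
  proof -
    note T = vector_field_tangent[OF XY(1)] vector_field_tangent[OF XY(2)]
    note s = vector_field_smooth[OF XY(1)] vector_field_smooth[OF XY(2)]
    have "X p (\<lambda>q. Y q (\<lambda>r. f r * g r)) = X p (\<lambda>q. Y q f * g q + f q * Y q g)"
      by (rule vector_field_apply_cong[OF XY(1) fg]) (rule tangent_mult[OF T(2)])
    then show ?thesis
      using fg s by (simp add: tangent_add[OF T(1)] tangent_mult[OF T(1)] smooth_near_mult)
  qed
  have add: "X p (\<lambda>q. Y q (\<lambda>r. f r + g r)) = X p (\<lambda>q. Y q f) + X p (\<lambda>q. Y q g)"
    if XY: "X \<in> vector_fields A" "Y \<in> vector_fields A" and fg: "smooth_near A p f" "smooth_near A p g"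
    for X Y p f g
  proof -
    have "X p (\<lambda>q. Y q (\<lambda>r. f r + g r)) = X p (\<lambda>q. Y q f + Y q g)"
      by (rule vector_field_apply_cong[OF XY(1) fg]) (rule vector_field_add[OF XY(2)])
    then show ?thesis
      using fg by (simp add: vector_field_add[OF XY(1)] vector_field_smooth[OF XY(2)])
  qed
  have scale: "X p (\<lambda>q. Y q (\<lambda>r. a * f r)) = a * X p (\<lambda>q. Y q f)"
    if XY: "X \<in> vector_fields A" "Y \<in> vector_fields A" and f: "smooth_near A p f"
    for X Y p f and a :: real
  proof -
    note T = vector_field_tangent[OF XY(1)] vector_field_tangent[OF XY(2)]
    have "X p (\<lambda>q. Y q (\<lambda>r. a * f r)) = X p (\<lambda>q. a * Y q f)"
      by (rule vector_field_apply_cong[OF XY(1) f f]) (rule tangent_scale[OF T(2)])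
    then show ?thesis
      using f by (simp add: tangent_scale[OF T(1)] vector_field_smooth[OF XY(2)])
  qed
  show "lie_bracket A X Y p \<in> tangent_space A p" for p
    unfolding tangent_space_def
    by (auto simp: lie_bracket_def smooth_near_add smooth_near_mult smooth_near_scale
        add[OF X Y] add[OF Y X] prod[OF X Y] prod[OF Y X] scale[OF X Y] scale[OF Y X] algebra_simps)
  show "lie_bracket A X Y p = (\<lambda>f. 0)" if "p \<notin> points A" for p
    using that smooth_near_in_points[of p] by (auto simp: lie_bracket_def fun_eq_iff)
  show "smooth_near A p (\<lambda>q. lie_bracket A X Y q f)" if f: "smooth_near A p f" for p f
  proof -
    obtain W where W: "openin (atlas_topology A) W" "p \<in> W" "\<And>q. q \<in> W \<Longrightarrow> smooth_near A q f"
      using smooth_near_open[OF f] by blast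
    have "smooth_near A p (\<lambda>q. X q (\<lambda>r. Y r f) - Y q (\<lambda>r. X r f))"
      using f s by (intro smooth_near_diff) auto
    then show ?thesis
      by (rule smooth_near_cong[OF W(1,2), rotated]) (simp add: lie_bracket_apply W(3))
  qed
qed

lemma lie_bracket_antisym: "lie_bracket A X Y = (\<lambda>p f. - lie_bracket A Y X p f)"
  by (auto simp: lie_bracket_def fun_eq_iff)

lemma lie_bracket_add_right:
  assumes "X \<in> vector_fields A" "Y \<in> vector_fields A" "Z \<in> vector_fields A"
  shows "lie_bracket A X (vf_add Y Z) = vf_add (lie_bracket A X Y) (lie_bracket A X Z)"
  using assms
  by (auto simp: fun_eq_iff lie_bracket_def vf_add_def vector_field_add[OF assms(1)] vector_field_smooth)

lemma lie_bracket_zero_right: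
  assumes "X \<in> vector_fields A"
  shows "lie_bracket A X (\<lambda>p f. 0) = (\<lambda>p f. 0)"
  using tangent_const[OF vector_field_tangent[OF assms]] smooth_near_in_points
  by (auto simp: fun_eq_iff lie_bracket_def)

lemma jacobi:
  assumes "X \<in> vector_fields A" "Y \<in> vector_fields A" "Z \<in> vector_fields A"
  shows "lie_bracket A X (lie_bracket A Y Z) =
    vf_add (lie_bracket A (lie_bracket A X Y) Z) (lie_bracket A Y (lie_bracket A X Z))"
proof (intro ext)
  fix p f
  have step: "X p (\<lambda>q. lie_bracket A Y Z q f) = X p (\<lambda>q. Y q (\<lambda>r. Z r f)) - X p (\<lambda>q. Z q (\<lambda>r. Y r f))"
    if "X \<in> vector_fields A" "Y \<in> vector_fields A" "Z \<in> vector_fields A" "smooth_near A p f" for X Y Z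
  proof -
    have "X p (\<lambda>q. lie_bracket A Y Z q f) = X p (\<lambda>q. Y q (\<lambda>r. Z r f) - Z q (\<lambda>r. Y r f))"
      by (rule vector_field_apply_cong[OF that(1) that(4) that(4)]) (simp add: lie_bracket_apply)
    then show ?thesis using that by (simp add: vector_field_diff[OF that(1)] vector_field_smooth)
  qed
  show "lie_bracket A X (lie_bracket A Y Z) p f =
      vf_add (lie_bracket A (lie_bracket A X Y) Z) (lie_bracket A Y (lie_bracket A X Z)) p f"
    using assms
    by (cases "smooth_near A p f") (simp_all add: vf_add_def lie_bracket_apply step vector_field_smooth,
      simp add: lie_bracket_def)
qed

end

section \<open>The slit tangent bundle as a manifold\<close>

lemma sum_Basis_vec: "(\<Sum>b\<in>(Basis :: (real^'n) set). F b) = (\<Sum>i\<in>UNIV. F (axis i 1))"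
proof -
  have "(Basis :: (real^'n) set) = range (\<lambda>i. axis i 1)"
    by (auto simp: Basis_vec_def)
  moreover have "inj (\<lambda>i. axis i 1 :: real^'n)"
    by (auto simp: inj_on_def axis_eq_axis)
  ultimately show ?thesis by (metis (no_types, lifting) sum.reindex_cong)
qed

locale slit_bundle = smooth_atlas_space A for A :: "('p, real^'n) atlas"
begin

abbreviation "B \<equiv> slit_tangent_bundle A"

text \<open>The part of the slit tangent bundle over \<open>W\<close>. Over a chart domain it is a chart domain of the
  bundle, and \<open>bundle_chart\<close> is its coordinate map.\<close>

definition slit_over :: "'p set \<Rightarrow> 'p tpoint set" where
  "slit_over W = {u. fst u \<in> W \<and> snd u \<in> tangent_space A (fst u) \<and> snd u \<noteq> (\<lambda>f. 0)}"

definition bundle_chart :: "('p \<Rightarrow> real^'n) \<Rightarrow> 'p tpoint \<Rightarrow> (real^'n) \<times> (real^'n)" where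
  "bundle_chart \<phi> u = (\<phi> (fst u), \<chi> i. snd u (\<lambda>q. \<phi> q $ i))"

text \<open>The fibrewise linear function on the bundle that a function on the base defines.\<close>

definition lift :: "('p \<Rightarrow> real) \<Rightarrow> 'p tpoint \<Rightarrow> real" where
  "lift g u = snd u g"

lemma slit_bundle_charts: "B = (\<lambda>(U, \<phi>). (slit_over U, bundle_chart \<phi>)) ` A"
proof -
  have "(case induced_chart A c of (V, \<psi>) \<Rightarrow> (V \<inter> {u. snd u \<noteq> (\<lambda>f. 0)}, \<psi>)) =
      (case c of (U, \<phi>) \<Rightarrow> (slit_over U, bundle_chart \<phi>))" for c
    by (auto simp: induced_chart_def slit_over_def bundle_chart_def fun_eq_iff split: prod.splits)
  then show ?thesis
    by (auto simp: slit_tangent_bundle_def restrict_atlas_def tangent_bundle_def image_image)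
qed

lemma bundle_chartI: "(U, \<phi>) \<in> A \<Longrightarrow> (slit_over U, bundle_chart \<phi>) \<in> B"
  by (force simp: slit_bundle_charts)

lemma slit_over_mono: "W \<subseteq> W' \<Longrightarrow> slit_over W \<subseteq> slit_over W'"
  by (auto simp: slit_over_def)

lemma slit_over_Int: "slit_over W \<inter> slit_over W' = slit_over (W \<inter> W')"
  by (auto simp: slit_over_def)

lemma points_slit: "points B = slit_over (points A)"
  unfolding points_def slit_bundle_charts by (fastforce simp: slit_over_def)

lemma component_smooth: "(U, \<phi>) \<in> A \<Longrightarrow> p \<in> U \<Longrightarrow> smooth_near A p (\<lambda>q. \<phi> q $ i)"
  using smooth_near_coordinate[of U \<phi> "\<lambda>x. x $ i"] bounded_linear_vec_nth by blast

lemma expansion: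
  assumes "v \<in> tangent_space A p" "(U, \<phi>) \<in> A" "p \<in> U" "smooth_near A p f"
  shows "v f = (\<Sum>i\<in>UNIV. v (\<lambda>q. \<phi> q $ i) * coord_vector A (U, \<phi>) (axis i 1) p f)"
  using tangent_expansion[OF assms] assms(4)
  by (simp add: sum_Basis_vec inner_axis coord_vector_def)

lemma tangent_eq_componentsI:
  assumes "v \<in> tangent_space A p" "w \<in> tangent_space A p" "(U, \<phi>) \<in> A" "p \<in> U"
    and "\<And>i. v (\<lambda>q. \<phi> q $ i) = w (\<lambda>q. \<phi> q $ i)"
  shows "v = w"
  by (rule tangent_eqI[OF assms(1-4)]) (use assms(5) in \<open>auto simp: Basis_vec_def inner_axis\<close>)

lemma coord_vector_component:
  assumes "(U, \<phi>) \<in> A" "p \<in> U"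
  shows "coord_vector A (U, \<phi>) (axis i 1) p (\<lambda>q. \<phi> q $ j) = (if i = j then 1 else 0)"
  using coord_vector_coordinate[OF assms, of "axis i 1" "axis j 1"]
  by (simp only: inner_axis_axis) (simp add: inner_axis)

text \<open>The inverse of a bundle chart.\<close>

definition chart_point :: "'p set \<Rightarrow> ('p \<Rightarrow> real^'n) \<Rightarrow> (real^'n) \<times> (real^'n) \<Rightarrow> 'p tpoint" where
  "chart_point U \<phi> z = (inv_into U \<phi> (fst z),
     \<lambda>f. \<Sum>i\<in>UNIV. snd z $ i * coord_vector A (U, \<phi>) (axis i 1) (inv_into U \<phi> (fst z)) f)"

lemma chart_point:
  assumes c: "(U, \<phi>) \<in> A" and z: "fst z \<in> \<phi> ` (U \<inter> W)" "snd z \<noteq> 0"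
  shows "chart_point U \<phi> z \<in> slit_over (U \<inter> W)" "bundle_chart \<phi> (chart_point U \<phi> z) = z"
proof -
  let ?p = "inv_into U \<phi> (fst z)"
  have p: "?p \<in> U" "?p \<in> W" "\<phi> ?p = fst z" using z c by auto
  let ?v = "snd (chart_point U \<phi> z)"
  have v: "?v \<in> tangent_space A ?p"
    unfolding chart_point_def snd_conv
    by (intro tangent_space_sum coord_vector_tangent c p)
  have y: "?v (\<lambda>q. \<phi> q $ j) = snd z $ j" for j
    by (simp add: chart_point_def coord_vector_component[OF c p(1)] if_distrib cong: if_cong)
  have "?v \<noteq> (\<lambda>f. 0)"
  proof
    assume "?v = (\<lambda>f. 0)"
    then have "snd z $ j = 0" for j using y[of j] by simp
    then show False using z(2) by (simp add: vec_eq_iff)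
  qed
  then show "chart_point U \<phi> z \<in> slit_over (U \<inter> W)"
    using p v by (simp add: slit_over_def) (simp add: chart_point_def)
  show "bundle_chart \<phi> (chart_point U \<phi> z) = z"
    using p y by (simp add: bundle_chart_def prod_eq_iff vec_eq_iff) (simp add: chart_point_def)
qed

text \<open>Injectivity holds on the whole tangent bundle over \<open>U\<close>, zero section included; this is needed to
  compare coordinate vectors taken in the full and in the slit chart.\<close>

lemma bundle_chart_inj:
  assumes c: "(U, \<phi>) \<in> A"
  shows "inj_on (bundle_chart \<phi>) (SIGMA p : U. tangent_space A p)"
proof (rule inj_onI, safe)
  fix p v q w
  assume *: "p \<in> U" "v \<in> tangent_space A p" "q \<in> U" "w \<in> tangent_space A q"
    "bundle_chart \<phi> (p, v) = bundle_chart \<phi> (q, w)"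
  then show pq: "p = q"
    using chart_inj[OF c] by (auto simp: bundle_chart_def inj_on_def)
  show "v = w"
    by (rule tangent_eq_componentsI[OF *(2) _ c *(1)]) (use * pq in \<open>auto simp: bundle_chart_def vec_eq_iff\<close>)
qed

lemma slit_over_subset_Sigma: "slit_over U \<subseteq> (SIGMA p : U. tangent_space A p)"
  by (auto simp: slit_over_def)

lemma bundle_chart_inj_slit: "(U, \<phi>) \<in> A \<Longrightarrow> inj_on (bundle_chart \<phi>) (slit_over U)"
  using bundle_chart_inj inj_on_subset slit_over_subset_Sigma by blast

lemma bundle_chart_image:
  assumes c: "(U, \<phi>) \<in> A"
  shows "bundle_chart \<phi> ` slit_over (U \<inter> W) = \<phi> ` (U \<inter> W) \<times> (- {0 :: real^'n})"
proof (intro equalityI subsetI)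
  fix z assume "z \<in> bundle_chart \<phi> ` slit_over (U \<inter> W)"
  then obtain p v where z: "z = bundle_chart \<phi> (p, v)" "p \<in> U" "p \<in> W"
    "v \<in> tangent_space A p" "v \<noteq> (\<lambda>f. 0)"
    by (auto simp: slit_over_def)
  have "snd z \<noteq> 0"
  proof
    assume "snd z = 0"
    then have "v (\<lambda>q. \<phi> q $ i) = 0" for i
      using z(1) by (auto simp: bundle_chart_def vec_eq_iff)
    then have "v = (\<lambda>f. 0)"
      using tangent_eq_componentsI[OF z(4) tangent_space_0 c z(2)] by simp
    with z(5) show False by simp
  qed
  then show "z \<in> \<phi> ` (U \<inter> W) \<times> (- {0})"
    using z by (auto simp: bundle_chart_def)
next
  fix z assume z: "z \<in> \<phi> ` (U \<inter> W) \<times> (- {0 :: real^'n})"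
  then have *: "fst z \<in> \<phi> ` (U \<inter> W)" "snd z \<noteq> 0" by auto
  have "bundle_chart \<phi> (chart_point U \<phi> z) \<in> bundle_chart \<phi> ` slit_over (U \<inter> W)"
    by (rule imageI[OF chart_point(1)[OF c *]])
  then show "z \<in> bundle_chart \<phi> ` slit_over (U \<inter> W)"
    by (simp add: chart_point(2)[OF c *])
qed

lemma bundle_chart_inv:
  assumes c: "(U, \<phi>) \<in> A" and z: "z \<in> \<phi> ` (U \<inter> W) \<times> (- {0 :: real^'n})"
  shows "inv_into (slit_over U) (bundle_chart \<phi>) z = chart_point U \<phi> z"
proof -
  have *: "fst z \<in> \<phi> ` (U \<inter> UNIV)" "snd z \<noteq> 0" using z by auto
  show ?thesis
    using inv_into_f_f[OF bundle_chart_inj_slit[OF c], of "chart_point U \<phi> z"] chart_point[OF c *]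
    by simp
qed

text \<open>In coordinates the lift is \<open>\<Sum> y\<^sup>i \<partial>g/\<partial>x\<^sup>i\<close>. Applied to the coordinate functions of a second chart
  it also shows that the transition maps of the bundle are smooth.\<close>

lemma lift_smooth_on:
  assumes c: "(U, \<phi>) \<in> A" and W: "openin (atlas_topology A) W" and g: "smooth_fun_on A W g"
  shows "smooth_on (\<lambda>z. lift g (chart_point U \<phi> z)) (\<phi> ` (U \<inter> W) \<times> (- {0}))"
proof -
  let ?O = "\<phi> ` (U \<inter> W) \<times> (- {0 :: real^'n})"
  let ?D = "\<lambda>z e. frechet_derivative (g \<circ> inv_into U \<phi>) (at (fst z)) e"
  have op: "open ?O"
    using chart_image_open[OF c W] by (intro open_Times) auto
  have "smooth_on (\<lambda>z. \<Sum>i\<in>UNIV. snd z $ i * ?D z (axis i 1)) ?O"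
  proof (intro smooth_on_sum smooth_on_mult op)
    fix i
    show "smooth_on (\<lambda>z :: (real^'n) \<times> (real^'n). snd z $ i) ?O"
      by (rule smooth_on_bounded_linear[OF bounded_linear_compose[OF bounded_linear_vec_nth bounded_linear_snd]])
    show "smooth_on (\<lambda>z. ?D z (axis i 1)) ?O"
      by (rule smooth_on_compose[OF op _ smooth_on_bounded_linear[OF bounded_linear_fst]
            smooth_on_directional_derivative[OF smooth_fun_onD[OF g c]]]) auto
  qed
  then show ?thesis
  proof (rule smooth_on_cong[OF op])
    fix z assume "z \<in> ?O"
    then have "fst z \<in> \<phi> ` (U \<inter> W)" by auto
    then obtain p where p: "p \<in> U" "p \<in> W" "fst z = \<phi> p" by blast
    have "smooth_near A p g" using g W p by (auto simp: smooth_near_def)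
    then show "(\<Sum>i\<in>UNIV. snd z $ i * ?D z (axis i 1)) = lift g (chart_point U \<phi> z)"
      using p c by (simp add: lift_def chart_point_def coord_vector_def)
  qed
qed

text \<open>The transition from \<open>\<phi>\<close> to \<open>\<psi>\<close> sends \<open>(x, y)\<close> to the transition of \<open>M\<close> at \<open>x\<close> together with
  the lifts of the components of \<open>\<psi>\<close>.\<close>

lemma smooth_atlas_slit: "smooth_atlas B"
  unfolding smooth_atlas_def
proof (intro conjI ballI; clarify)
  fix U' \<Phi> assume "(U', \<Phi>) \<in> B"
  then obtain U \<phi> where c: "(U, \<phi>) \<in> A" and eq: "U' = slit_over U" "\<Phi> = bundle_chart \<phi>"
    by (auto simp: slit_bundle_charts)
  have "open (\<phi> ` (U \<inter> UNIV))" using transition(1)[OF c c] by simp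
  then show "inj_on \<Phi> U' \<and> open (\<Phi> ` U')"
    using bundle_chart_image[OF c, of UNIV] bundle_chart_inj_slit[OF c] eq
    by (auto intro!: open_Times)
  fix V' \<Psi> assume "(V', \<Psi>) \<in> B"
  then obtain V \<psi> where d: "(V, \<psi>) \<in> A" and eq': "V' = slit_over V" "\<Psi> = bundle_chart \<psi>"
    by (auto simp: slit_bundle_charts)
  let ?O = "\<phi> ` (U \<inter> V) \<times> (- {0 :: real^'n})"
  have im: "\<Phi> ` (U' \<inter> V') = ?O"
    unfolding eq eq' slit_over_Int by (rule bundle_chart_image[OF c])
  have op: "open ?O"
    using transition(1)[OF c d] by (intro open_Times) auto
  have "smooth_on (\<lambda>z. ((\<psi> \<circ> inv_into U \<phi>) (fst z), \<chi> i. lift (\<lambda>q. \<psi> q $ i) (chart_point U \<phi> z))) ?O"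
  proof (intro smooth_on_Pair smooth_on_vec_lambda op)
    show "smooth_on (\<lambda>z :: (real^'n) \<times> (real^'n). (\<psi> \<circ> inv_into U \<phi>) (fst z)) ?O"
      by (rule smooth_on_compose[OF op _ smooth_on_bounded_linear[OF bounded_linear_fst]
            transition(2)[OF c d]]) auto
    show "smooth_on (\<lambda>z. lift (\<lambda>q. \<psi> q $ i) (chart_point U \<phi> z)) ?O" for i
      by (rule lift_smooth_on[OF c chart_domain_open[OF d]
            smooth_fun_on_coordinate[OF d bounded_linear_vec_nth]])
  qed
  then have "smooth_on (\<Psi> \<circ> inv_into U' \<Phi>) ?O"
    by (rule smooth_on_cong[OF op])
      (simp add: eq eq' bundle_chart_inv[OF c] bundle_chart_def lift_def, simp add: chart_point_def)
  then show "open (\<Phi> ` (U' \<inter> V')) \<and> smooth_on (\<Psi> \<circ> inv_into U' \<Phi>) (\<Phi> ` (U' \<inter> V'))"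
    using op by (simp add: im)
qed

end

sublocale slit_bundle \<subseteq> slit: smooth_atlas_space "slit_tangent_bundle A"
  by unfold_locales (rule smooth_atlas_slit)

context slit_bundle
begin

lemma slit_over_open:
  assumes "openin (atlas_topology A) W"
  shows "openin (atlas_topology B) (slit_over W)"
  unfolding slit.openin_atlas_iff
proof (intro conjI ballI; clarify)
  show "u \<in> slit_over W \<Longrightarrow> u \<in> points B" for u
    using openin_subset_points[OF assms] slit_over_mono points_slit by blast
  fix U' \<Phi> assume "(U', \<Phi>) \<in> B"
  then obtain U \<phi> where c: "(U, \<phi>) \<in> A" and eq: "U' = slit_over U" "\<Phi> = bundle_chart \<phi>"
    by (auto simp: slit_bundle_charts)
  show "open (\<Phi> ` (U' \<inter> slit_over W))"
    unfolding eq slit_over_Int bundle_chart_image[OF c]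
    using chart_image_open[OF c assms] by (intro open_Times) auto
qed

lemma slit_pointD:
  assumes "u \<in> points B"
  shows "fst u \<in> points A" "snd u \<in> tangent_space A (fst u)" "fst u \<in> W \<Longrightarrow> u \<in> slit_over W"
  using assms by (auto simp: points_slit slit_over_def)

lemma slit_chart_around:
  assumes "u \<in> points B"
  obtains U \<phi> where "(U, \<phi>) \<in> A" "fst u \<in> U" "u \<in> slit_over U"
  using chart_around[OF slit_pointD(1)[OF assms]] slit_pointD(3)[OF assms] by metis

lemma smooth_near_slitI:
  assumes u: "u \<in> points B" and W: "openin (atlas_topology A) W" "fst u \<in> W"
    and f: "\<And>U \<phi>. (U, \<phi>) \<in> A \<Longrightarrow>
      smooth_on (\<lambda>z. f (chart_point U \<phi> z)) (\<phi> ` (U \<inter> W) \<times> (- {0}))"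
  shows "smooth_near B u f"
proof -
  obtain U \<phi> where c: "(U, \<phi>) \<in> A" "fst u \<in> U" "u \<in> slit_over U"
    by (rule slit_chart_around[OF u])
  let ?O = "\<phi> ` (U \<inter> W) \<times> (- {0 :: real^'n})"
  have op: "open ?O"
    using chart_image_open[OF c(1) W(1)] by (intro open_Times) auto
  show ?thesis
  proof (rule slit.smooth_near_chartI[OF bundle_chartI[OF c(1)] c(3) op])
    show "bundle_chart \<phi> u \<in> ?O"
      using slit_pointD(3)[OF u, of "U \<inter> W"] c W unfolding bundle_chart_image[OF c(1), symmetric]
      by blast
    show "?O \<subseteq> bundle_chart \<phi> ` slit_over U"
      unfolding bundle_chart_image[OF c(1), symmetric] by (intro image_mono slit_over_mono) auto
    show "smooth_on (f \<circ> inv_into (slit_over U) (bundle_chart \<phi>)) ?O"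
      by (rule smooth_on_cong[OF op f[OF c(1)]]) (simp add: bundle_chart_inv[OF c(1)])
  qed
qed

lemma pullback_smooth:
  assumes u: "u \<in> points B" and g: "smooth_near A (fst u) g"
  shows "smooth_near B u (g \<circ> fst)"
proof -
  obtain W where W: "openin (atlas_topology A) W" "fst u \<in> W" "smooth_fun_on A W g"
    using g by (auto simp: smooth_near_def)
  show ?thesis
  proof (rule smooth_near_slitI[OF u W(1,2)])
    fix U \<phi> assume c: "(U, \<phi>) \<in> A"
    let ?O = "\<phi> ` (U \<inter> W) \<times> (- {0 :: real^'n})"
    have op: "open ?O"
      using chart_image_open[OF c W(1)] by (intro open_Times) auto
    have "smooth_on (\<lambda>z :: (real^'n) \<times> (real^'n). (g \<circ> inv_into U \<phi>) (fst z)) ?O"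
      by (rule smooth_on_compose[OF op _ smooth_on_bounded_linear[OF bounded_linear_fst]
            smooth_fun_onD[OF W(3) c]]) auto
    then show "smooth_on (\<lambda>z. (g \<circ> fst) (chart_point U \<phi> z)) ?O"
      by (simp add: chart_point_def)
  qed
qed

lemma lift_smooth:
  assumes u: "u \<in> points B" and g: "smooth_near A (fst u) g"
  shows "smooth_near B u (lift g)"
proof -
  obtain W where W: "openin (atlas_topology A) W" "fst u \<in> W" "smooth_fun_on A W g"
    using g by (auto simp: smooth_near_def)
  show ?thesis
    by (rule smooth_near_slitI[OF u W(1,2)]) (rule lift_smooth_on[OF _ W(1,3)])
qed

text \<open>The pullbacks and the lifts of the coordinates of \<open>M\<close> are the coordinates of the bundle.\<close>

lemma slit_tangent_eqI:
  assumes u: "u \<in> points B" and "\<xi> \<in> tangent_space B u" "\<eta> \<in> tangent_space B u"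
    and "\<And>g. smooth_near A (fst u) g \<Longrightarrow> \<xi> (g \<circ> fst) = \<eta> (g \<circ> fst)"
    and "\<And>g. smooth_near A (fst u) g \<Longrightarrow> \<xi> (lift g) = \<eta> (lift g)"
  shows "\<xi> = \<eta>"
proof -
  obtain U \<phi> where c: "(U, \<phi>) \<in> A" "fst u \<in> U" "u \<in> slit_over U"
    by (rule slit_chart_around[OF u])
  show ?thesis
  proof (rule slit.tangent_eqI[OF assms(2,3) bundle_chartI[OF c(1)] c(3)])
    fix b :: "(real^'n) \<times> (real^'n)" assume "b \<in> Basis"
    then consider i where "b = (axis i 1, 0)" | i where "b = (0, axis i 1)"
      by (auto simp: Basis_prod_def Basis_vec_def)
    then show "\<xi> (\<lambda>w. bundle_chart \<phi> w \<bullet> b) = \<eta> (\<lambda>w. bundle_chart \<phi> w \<bullet> b)"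
    proof cases
      case 1
      then have "(\<lambda>w. bundle_chart \<phi> w \<bullet> b) = (\<lambda>q. \<phi> q $ i) \<circ> fst"
        by (simp add: bundle_chart_def inner_axis fun_eq_iff)
      then show ?thesis using assms(4) component_smooth[OF c(1,2)] by simp
    next
      case 2
      then have "(\<lambda>w. bundle_chart \<phi> w \<bullet> b) = lift (\<lambda>q. \<phi> q $ i)"
        by (simp add: bundle_chart_def inner_axis fun_eq_iff lift_def)
      then show ?thesis using assms(5) component_smooth[OF c(1,2)] by simp
    qed
  qed
qed

text \<open>This makes the expansion of tangent vectors of \<open>M\<close> available for the values of a tangent vector of
  the bundle on pullbacks.\<close>

lemma differential_tangent:
  assumes u: "u \<in> points B" and \<xi>: "\<xi> \<in> tangent_space B u"
  shows "differential A fst u \<xi> \<in> tangent_space A (fst u)"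
proof -
  note s = pullback_smooth[OF u]
  have "\<xi> ((\<lambda>q. f q + g q) \<circ> fst) = \<xi> (f \<circ> fst) + \<xi> (g \<circ> fst)"
    "\<xi> ((\<lambda>q. f q * g q) \<circ> fst) = \<xi> (f \<circ> fst) * g (fst u) + f (fst u) * \<xi> (g \<circ> fst)"
    "\<xi> ((\<lambda>q. a * f q) \<circ> fst) = a * \<xi> (f \<circ> fst)"
    if "smooth_near A (fst u) f" "smooth_near A (fst u) g" for f g a
    using slit.tangent_add[OF \<xi> s[OF that(1)] s[OF that(2)]]
      slit.tangent_mult[OF \<xi> s[OF that(1)] s[OF that(2)]]
      slit.tangent_scale[OF \<xi> s[OF that(1)], of a]
    by (simp_all add: o_def)
  then show ?thesis
    unfolding tangent_space_def differential_def
    by (auto simp: smooth_near_add smooth_near_mult smooth_near_scale)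
qed

section \<open>The tangent structure and the second order property\<close>

text \<open>The vectors \<open>\<partial>/\<partial>y\<^sup>i\<close> are defined with the inverse of the chart of the full tangent bundle. Both
  inverses agree on the open image of the slit chart, so the derivatives agree.\<close>

lemma d_dy_coord_vector:
  assumes c: "(U, \<phi>) \<in> A" and u: "u \<in> slit_over U"
  shows "d_dy A (U, \<phi>) i u = coord_vector B (slit_over U, bundle_chart \<phi>) (0, axis i 1) u"
proof
  fix f
  let ?TU = "SIGMA p : U. tangent_space A p" and ?\<Phi> = "bundle_chart \<phi>"
  have ind: "induced_chart A (U, \<phi>) = (?TU, ?\<Phi>)"
    by (auto simp: induced_chart_def bundle_chart_def fun_eq_iff)
  show "d_dy A (U, \<phi>) i u f = coord_vector B (slit_over U, bundle_chart \<phi>) (0, axis i 1) u f"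
  proof (cases "smooth_near B u f")
    case True
    note b = bundle_chartI[OF c]
    have "frechet_derivative (f \<circ> inv_into (slit_over U) ?\<Phi>) (at (?\<Phi> u)) =
        frechet_derivative (f \<circ> inv_into ?TU ?\<Phi>) (at (?\<Phi> u))"
    proof (rule frechet_derivative_transform_within_open)
      show "f \<circ> inv_into (slit_over U) ?\<Phi> differentiable at (?\<Phi> u)"
        using slit.chart_has_derivative[OF b u True] by (auto simp: differentiable_def)
      show "open (?\<Phi> ` slit_over U)" using slit.transition(1)[OF b b] by simp
      fix z assume "z \<in> ?\<Phi> ` slit_over U"
      then obtain w where w: "w \<in> slit_over U" "z = ?\<Phi> w" by blast
      then show "(f \<circ> inv_into (slit_over U) ?\<Phi>) z = (f \<circ> inv_into ?TU ?\<Phi>) z"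
        using inv_into_f_f[OF bundle_chart_inj[OF c] subsetD[OF slit_over_subset_Sigma w(1)]]
          slit.chart_inv[OF b w(1)] by simp
    qed (use u in simp)
    then show ?thesis using True by (simp add: d_dy_def coord_vector_def ind)
  qed (simp add: d_dy_def coord_vector_def)
qed

text \<open>On pullbacks \<open>\<partial>/\<partial>y\<^sup>i\<close> vanishes, since its projection to \<open>M\<close> kills all coordinates. On a lift it is
  computed by the product rule from \<open>lift g = \<Sum> y\<^sup>j (\<partial>\<^sub>jg \<circ> \<pi>)\<close>: the pullbacks are killed and
  \<open>\<partial>y\<^sup>j/\<partial>y\<^sup>i\<close> is the Kronecker symbol.\<close>

lemma vertical_combination:
  fixes a :: "'n \<Rightarrow> real" and g :: "'p \<Rightarrow> real"
  assumes c: "(U, \<phi>) \<in> A" and u: "u \<in> slit_over U"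
  defines "\<eta> \<equiv> \<lambda>f. \<Sum>i\<in>UNIV. a i * d_dy A (U, \<phi>) i u f"
  shows "\<eta> \<in> tangent_space B u"
    and "smooth_near A (fst u) g \<Longrightarrow> \<eta> (g \<circ> fst) = 0"
    and "smooth_near A (fst u) g \<Longrightarrow>
      \<eta> (lift g) = (\<Sum>i\<in>UNIV. a i * coord_vector A (U, \<phi>) (axis i 1) (fst u) g)"
proof -
  note b = bundle_chartI[OF c]
  have p: "fst u \<in> U" "u \<in> points B" "snd u \<in> tangent_space A (fst u)"
    using u slit.chart_domain_subset[OF b] by (auto simp: slit_over_def)
  have T: "d_dy A (U, \<phi>) i u \<in> tangent_space B u" for i
    unfolding d_dy_coord_vector[OF c u] by (rule slit.coord_vector_tangent[OF b u])
  show "\<eta> \<in> tangent_space B u"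
    unfolding \<eta>_def by (intro slit.tangent_space_sum T)
  have base: "d_dy A (U, \<phi>) i u (g \<circ> fst) = 0" if "smooth_near A (fst u) g" for i g
  proof -
    have "differential A fst u (d_dy A (U, \<phi>) i u) = (\<lambda>f. 0)"
    proof (rule tangent_eq_componentsI[OF differential_tangent[OF p(2) T] tangent_space_0 c p(1)])
      fix j
      have "(\<lambda>q. \<phi> q $ j) \<circ> fst = (\<lambda>w. bundle_chart \<phi> w \<bullet> (axis j 1, 0))"
        by (simp add: bundle_chart_def inner_axis fun_eq_iff)
      then show "differential A fst u (d_dy A (U, \<phi>) i u) (\<lambda>q. \<phi> q $ j) = 0"
        by (simp add: differential_def d_dy_coord_vector[OF c u] slit.coord_vector_coordinate[OF b u])
    qed
    from fun_cong[OF this, of g] that show ?thesis by (simp add: differential_def)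
  qed
  then show "\<eta> (g \<circ> fst) = 0" if "smooth_near A (fst u) g"
    using that by (simp add: \<eta>_def)
  have fibre: "d_dy A (U, \<phi>) i u (lift g) = coord_vector A (U, \<phi>) (axis i 1) (fst u) g"
    if g: "smooth_near A (fst u) g" for i
  proof -
    let ?\<xi> = "d_dy A (U, \<phi>) i u" and ?y = "\<lambda>j. lift (\<lambda>q. \<phi> q $ j)"
    let ?D = "\<lambda>j q. coord_vector A (U, \<phi>) (axis j 1) q g"
    have sy: "smooth_near B u (?y j)" for j
      by (intro lift_smooth p component_smooth[OF c])
    have D: "smooth_near A (fst u) (?D j)" for j
      by (rule coord_vector_smooth[OF c p(1) g])
    have sD: "smooth_near B u (?D j \<circ> fst)" for j
      by (intro pullback_smooth p D)
    have y: "?\<xi> (?y j) = (if i = j then 1 else 0)" for j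
    proof -
      have "?y j = (\<lambda>w. bundle_chart \<phi> w \<bullet> (0, axis j 1))"
        by (simp add: bundle_chart_def inner_axis fun_eq_iff lift_def)
      then show ?thesis
        by (simp add: d_dy_coord_vector[OF c u] slit.coord_vector_coordinate[OF b u] inner_axis_axis)
    qed
    obtain W where W: "openin (atlas_topology A) W" "fst u \<in> W" "\<And>q. q \<in> W \<Longrightarrow> smooth_near A q g"
      using smooth_near_open[OF g] by blast
    let ?W = "slit_over (U \<inter> W)"
    have "?\<xi> (lift g) = ?\<xi> (\<lambda>w. \<Sum>j\<in>UNIV. ?y j w * (?D j \<circ> fst) w)"
    proof (rule slit.tangent_cong[OF T slit_over_open[of "U \<inter> W"]])
      show "openin (atlas_topology A) (U \<inter> W)"
        using chart_domain_open[OF c] W by blast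
      show "u \<in> ?W" by (rule slit_pointD(3)) (use p W in auto)
      fix w assume "w \<in> ?W"
      then have w: "fst w \<in> U" "fst w \<in> W" "snd w \<in> tangent_space A (fst w)"
        by (auto simp: slit_over_def)
      show "lift g w = (\<Sum>j\<in>UNIV. ?y j w * (?D j \<circ> fst) w)"
        using expansion[OF w(3) c w(1) W(3)[OF w(2)]] by (simp add: lift_def)
    qed
    also have "\<dots> = (\<Sum>j\<in>UNIV. ?\<xi> (\<lambda>w. ?y j w * (?D j \<circ> fst) w))"
      by (rule slit.tangent_sum[OF T p(2)]) (rule slit.smooth_near_mult[OF sy sD])
    also have "\<dots> = (\<Sum>j\<in>UNIV. if i = j then ?D j (fst u) else 0)"
    proof (intro sum.cong refl)
      fix j
      show "?\<xi> (\<lambda>w. ?y j w * (?D j \<circ> fst) w) = (if i = j then ?D j (fst u) else 0)"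
        using slit.tangent_mult[OF T sy[of j] sD[of j]] base[OF D[of j], of i] y[of j] by (simp add: o_def)
    qed
    also have "\<dots> = ?D i (fst u)" by simp
    finally show ?thesis .
  qed
  show "\<eta> (lift g) = (\<Sum>i\<in>UNIV. a i * coord_vector A (U, \<phi>) (axis i 1) (fst u) g)"
    if "smooth_near A (fst u) g"
    using fibre[OF that] by (simp add: \<eta>_def)
qed

lemma chart_at_props:
  assumes "u \<in> points B"
  obtains U \<phi> where "chart_at A (fst u) = (U, \<phi>)" "(U, \<phi>) \<in> A" "fst u \<in> U" "u \<in> slit_over U"
proof -
  obtain V \<psi> where "(V, \<psi>) \<in> A" "fst u \<in> V"
    using slit_chart_around[OF assms] by metis
  then have "\<exists>c. c \<in> A \<and> fst u \<in> fst c" by force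
  then have "chart_at A (fst u) \<in> A \<and> fst u \<in> fst (chart_at A (fst u))"
    unfolding chart_at_def by (rule someI_ex)
  then show ?thesis
    using that[of "fst (chart_at A (fst u))" "snd (chart_at A (fst u))"] slit_pointD(3)[OF assms] by simp
qed

text \<open>The choice \<open>a\<^sub>i = \<xi>(x\<^sup>i)\<close> gives the coordinate expression of the tangent structure. Its values on
  pullbacks and lifts do not mention the chart, so neither does the vector itself.\<close>

lemma vertical_lift_of_vector:
  assumes c: "(U, \<phi>) \<in> A" and u: "u \<in> slit_over U" and \<xi>: "\<xi> \<in> tangent_space B u"
  defines "\<eta> \<equiv> \<lambda>f. \<Sum>i\<in>UNIV. \<xi> (\<lambda>w. \<phi> (fst w) $ i) * d_dy A (U, \<phi>) i u f"
  shows "\<eta> \<in> tangent_space B u"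
    and "smooth_near A (fst u) g \<Longrightarrow> \<eta> (g \<circ> fst) = 0"
    and "smooth_near A (fst u) g \<Longrightarrow> \<eta> (lift g) = \<xi> (g \<circ> fst)"
proof -
  note v = vertical_combination[OF c u, where a = "\<lambda>i. \<xi> (\<lambda>w. \<phi> (fst w) $ i)"]
  show "\<eta> \<in> tangent_space B u" and "smooth_near A (fst u) g \<Longrightarrow> \<eta> (g \<circ> fst) = 0"
    using v(1,2) by (simp_all add: \<eta>_def)
  have p: "fst u \<in> U" "u \<in> points B"
    using u slit.chart_domain_subset[OF bundle_chartI[OF c]] by (auto simp: slit_over_def)
  show "\<eta> (lift g) = \<xi> (g \<circ> fst)" if g: "smooth_near A (fst u) g"
    using v(3)[OF g] g expansion[OF differential_tangent[OF p(2) \<xi>] c p(1) g] component_smooth[OF c p(1)]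
    by (simp add: \<eta>_def differential_def o_def)
qed

lemma tangent_structure_apply:
  assumes u: "u \<in> points B" and X: "X u \<in> tangent_space B u"
  shows "tangent_structure A X u \<in> tangent_space B u"
    and "smooth_near A (fst u) g \<Longrightarrow> tangent_structure A X u (g \<circ> fst) = 0"
    and "smooth_near A (fst u) g \<Longrightarrow> tangent_structure A X u (lift g) = X u (g \<circ> fst)"
proof -
  obtain U \<phi> where c: "chart_at A (fst u) = (U, \<phi>)" "(U, \<phi>) \<in> A" "fst u \<in> U" "u \<in> slit_over U"
    by (rule chart_at_props[OF u])
  have "tangent_structure A X u = (\<lambda>f. \<Sum>i\<in>UNIV. X u (\<lambda>w. \<phi> (fst w) $ i) * d_dy A (U, \<phi>) i u f)"
    by (simp add: tangent_structure_def c(1) fun_eq_iff)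
  with vertical_lift_of_vector[OF c(2,4) X]
  show "tangent_structure A X u \<in> tangent_space B u"
    "smooth_near A (fst u) g \<Longrightarrow> tangent_structure A X u (g \<circ> fst) = 0"
    "smooth_near A (fst u) g \<Longrightarrow> tangent_structure A X u (lift g) = X u (g \<circ> fst)"
    by simp_all
qed

lemma tangent_structure_chart:
  assumes c: "(U, \<phi>) \<in> A" and u: "u \<in> slit_over U" and X: "X u \<in> tangent_space B u"
  shows "tangent_structure A X u f =
    (\<Sum>i\<in>UNIV. X u ((\<lambda>q. \<phi> q $ i) \<circ> fst) * coord_vector B (slit_over U, bundle_chart \<phi>) (0, axis i 1) u f)"
proof -
  have p: "u \<in> points B" using u slit.chart_domain_subset[OF bundle_chartI[OF c]] by blast
  have "tangent_structure A X u = (\<lambda>f. \<Sum>i\<in>UNIV. X u (\<lambda>w. \<phi> (fst w) $ i) * d_dy A (U, \<phi>) i u f)"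
    by (rule slit_tangent_eqI[OF p])
      (simp_all add: tangent_structure_apply[where X = X, OF p X] vertical_lift_of_vector[OF c u X])
  then show ?thesis by (simp add: d_dy_coord_vector[OF c u] o_def)
qed

text \<open>Near a point, the coordinate expression in one fixed chart may be used, where all coefficients are
  visibly smooth. The definition of \<open>J\<close>, with its choice of a chart at each point, does not show this.\<close>

lemma tangent_structure_closed:
  assumes X: "X \<in> vector_fields B"
  shows "tangent_structure A X \<in> vector_fields B"
proof (rule slit.vector_fieldI)
  note T = slit.vector_field_tangent[OF X]
  show "u \<in> points B \<Longrightarrow> tangent_structure A X u \<in> tangent_space B u" for u
    by (rule tangent_structure_apply(1)[OF _ T])
  show "u \<notin> points B \<Longrightarrow> tangent_structure A X u = (\<lambda>f. 0)" for u
    by (simp add: tangent_structure_def slit.vector_field_outside[OF X])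
  fix u f assume f: "smooth_near B u f"
  then have u: "u \<in> points B" by (rule slit.smooth_near_in_points)
  obtain U \<phi> where c: "(U, \<phi>) \<in> A" "fst u \<in> U" "u \<in> slit_over U"
    by (rule slit_chart_around[OF u])
  note b = bundle_chartI[OF c(1)]
  have "smooth_near B u (\<lambda>w. \<Sum>i\<in>UNIV. X w ((\<lambda>q. \<phi> q $ i) \<circ> fst) *
      coord_vector B (slit_over U, bundle_chart \<phi>) (0, axis i 1) w f)"
    by (intro slit.smooth_near_sum[OF u] slit.smooth_near_mult slit.vector_field_smooth[OF X]
        pullback_smooth[OF u] component_smooth[OF c(1,2)] slit.coord_vector_smooth[OF b c(3) f])
  then show "smooth_near B u (\<lambda>w. tangent_structure A X w f)"
    by (rule slit.smooth_near_cong[OF slit.chart_domain_open[OF b] c(3), rotated])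
      (rule tangent_structure_chart[OF c(1) _ T, symmetric])
qed

lemma liouville_apply:
  assumes u: "u \<in> points B" and g: "smooth_near A (fst u) g"
  shows "liouville A u (lift g) = lift g u"
proof -
  obtain U \<phi> where c: "chart_at A (fst u) = (U, \<phi>)" "(U, \<phi>) \<in> A" "fst u \<in> U" "u \<in> slit_over U"
    by (rule chart_at_props[OF u])
  have "snd (snd (induced_chart A (U, \<phi>)) u) $ i = snd u (\<lambda>q. \<phi> q $ i)" for i
    by (simp add: induced_chart_def case_prod_beta)
  then show ?thesis
    using vertical_combination(3)[OF c(2,4) g, where a = "\<lambda>i. snd u (\<lambda>q. \<phi> q $ i)"]
      expansion[OF slit_pointD(2)[OF u] c(2,3) g]
    by (simp add: liouville_def c(1) lift_def)
qed

text \<open>The second order property of a semispray: compare both sides of \<open>JS = C\<close> on a lift.\<close>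

lemma semispray_pullback:
  assumes S: "semispray A S" and u: "u \<in> points B" and g: "smooth_near A (fst u) g"
  shows "S u (g \<circ> fst) = lift g u"
proof -
  have "S \<in> vector_fields B" "tangent_structure A S u = liouville A u"
    using S u by (auto simp: semispray_def)
  then show ?thesis
    using tangent_structure_apply(3)[where X = S, OF u slit.vector_field_tangent[of S u] g] liouville_apply[OF u g] by simp
qed

end

section \<open>The exterior derivative of a one-form\<close>

lemma vanishes_two_iff:
  "vanishes M 2 \<omega> \<longleftrightarrow>
    (\<forall>X\<in>vector_fields M. \<forall>Y\<in>vector_fields M. \<forall>p\<in>points M. \<omega> [X, Y] p = 0)"
proof
  assume "vanishes M 2 \<omega>"
  then have *: "Xs \<in> vf_tuples M 2 \<Longrightarrow> p \<in> points M \<Longrightarrow> \<omega> Xs p = 0" for Xs p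
    by (simp add: vanishes_def)
  show "\<forall>X\<in>vector_fields M. \<forall>Y\<in>vector_fields M. \<forall>p\<in>points M. \<omega> [X, Y] p = 0"
    by (intro ballI *) (simp_all add: vf_tuples_def)
next
  assume *: "\<forall>X\<in>vector_fields M. \<forall>Y\<in>vector_fields M. \<forall>p\<in>points M. \<omega> [X, Y] p = 0"
  show "vanishes M 2 \<omega>"
    unfolding vanishes_def
  proof (intro ballI)
    fix Xs p assume "Xs \<in> vf_tuples M 2" and p: "p \<in> points M"
    then have Xs: "length Xs = Suc (Suc 0)" "set Xs \<subseteq> vector_fields M"
      by (simp_all add: vf_tuples_def)
    then obtain X Y where "Xs = [X, Y]" by (auto simp: length_Suc_conv)
    then show "\<omega> Xs p = 0" using * Xs(2) p by simp
  qed
qed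

lemma ext_deriv_two:
  "ext_deriv M \<alpha> [X, Y] p = X p (\<alpha> [Y]) - Y p (\<alpha> [X]) - \<alpha> [lie_bracket M X Y] p"
  by (simp add: ext_deriv_def omit_def numeral_2_eq_2 lessThan_Suc)

lemma tensor_deriv_two:
  "tensor_deriv M T \<alpha> [X, Y] p = ext_deriv M \<alpha> [T X, Y] p + ext_deriv M \<alpha> [X, T Y] p -
    (X p (\<alpha> [T Y]) - Y p (\<alpha> [T X]) - \<alpha> [T (lie_bracket M X Y)] p)"
proof -
  have "insertion T \<alpha> [Z] = \<alpha> [T Z]" for Z
    by (simp add: insertion_def fun_eq_iff)
  moreover have "insertion T \<omega> [X, Y] p = \<omega> [T X, Y] p + \<omega> [X, T Y] p" for \<omega>
    by (simp add: insertion_def numeral_2_eq_2 lessThan_Suc)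
  ultimately show ?thesis by (simp add: tensor_deriv_def ext_deriv_two)
qed

context smooth_atlas_space
begin

abbreviation "VF \<equiv> vector_fields A"

lemma form_smooth:
  assumes "\<theta> \<in> differential_forms A 1" "X \<in> VF" "p \<in> points A"
  shows "smooth_near A p (\<theta> [X])"
proof -
  have "[X] \<in> vf_tuples A 1" using assms by (simp add: vf_tuples_def)
  then have "smooth_fun_on A (points A) (\<theta> [X])"
    using assms(1) by (simp add: differential_forms_def)
  then show ?thesis using openin_points assms(3) by (auto simp: smooth_near_iff)
qed

lemma form_linear:
  assumes "\<theta> \<in> differential_forms A 1" "X \<in> VF" "Y \<in> VF" "p \<in> points A"
  shows "\<theta> [\<lambda>p f. a * X p f + b * Y p f] p = a * \<theta> [X] p + b * \<theta> [Y] p"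
proof -
  have "\<forall>Xs\<in>vf_tuples A 1. \<forall>i<1. \<forall>X\<in>VF. \<forall>Y\<in>VF. \<forall>a b.
      smooth_fun_on A (points A) a \<longrightarrow> smooth_fun_on A (points A) b \<longrightarrow>
      (\<forall>p\<in>points A. \<theta> (Xs[i := vf_add (vf_scale a X) (vf_scale b Y)]) p =
         a p * \<theta> (Xs[i := X]) p + b p * \<theta> (Xs[i := Y]) p)"
    using assms(1) unfolding differential_forms_def by blast
  moreover have "[X] \<in> vf_tuples A 1" using assms by (simp add: vf_tuples_def)
  ultimately have "\<theta> ([X][0 := vf_add (vf_scale (\<lambda>p. a) X) (vf_scale (\<lambda>p. b) Y)]) p =
      a * \<theta> ([X][0 := X]) p + b * \<theta> ([X][0 := Y]) p"
    using assms(2-4) smooth_fun_on_const by blast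
  then show ?thesis by (simp add: vf_add_def vf_scale_def)
qed

lemma form_add:
  assumes "\<theta> \<in> differential_forms A 1" "X \<in> VF" "Y \<in> VF" "p \<in> points A"
  shows "\<theta> [vf_add X Y] p = \<theta> [X] p + \<theta> [Y] p"
  using form_linear[OF assms, of 1 1] by (simp add: vf_add_def)

lemma form_minus:
  assumes "\<theta> \<in> differential_forms A 1" "X \<in> VF" "p \<in> points A"
  shows "\<theta> [\<lambda>p f. - X p f] p = - \<theta> [X] p"
  using form_linear[OF assms(1,2,2,3), of "-1" 0] by simp

lemma vf_diff_cancel: "vf_add (vf_diff X Y) Y = X"
  by (simp add: vf_add_def vf_diff_def)

lemma lie_bracket_diff_right:
  assumes "X \<in> VF" "Y \<in> VF" "Z \<in> VF"
  shows "lie_bracket A X (vf_diff Y Z) = vf_diff (lie_bracket A X Y) (lie_bracket A X Z)"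
  using lie_bracket_add_right[OF assms(1) vf_diff_closed[OF assms(2,3)] assms(3)]
  by (auto simp: vf_diff_cancel vf_add_def vf_diff_def fun_eq_iff)

lemma vector_field_vanishing:
  assumes "X \<in> VF" "\<And>q. q \<in> points A \<Longrightarrow> f q = 0"
  shows "X p f = 0"
  using vector_field_eq_on_points[OF assms(1), of f "\<lambda>q. 0" p] assms(2)
    tangent_const[OF vector_field_tangent[OF assms(1)]] vector_field_outside[OF assms(1)]
  by (cases "p \<in> points A") auto

lemma ext_deriv_antisym:
  assumes "\<theta> \<in> differential_forms A 1" "X \<in> VF" "Y \<in> VF" "p \<in> points A"
  shows "ext_deriv A \<theta> [X, Y] p = - ext_deriv A \<theta> [Y, X] p"
  using form_minus[OF assms(1) lie_bracket_closed[OF assms(3,2)] assms(4)]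
  by (simp add: ext_deriv_two lie_bracket_antisym[of X Y])

lemma ext_deriv_add_right:
  assumes \<theta>: "\<theta> \<in> differential_forms A 1" and XF: "X \<in> VF" "Y \<in> VF" "Z \<in> VF" and p: "p \<in> points A"
  shows "ext_deriv A \<theta> [X, vf_add Y Z] p = ext_deriv A \<theta> [X, Y] p + ext_deriv A \<theta> [X, Z] p"
proof -
  have "X p (\<theta> [vf_add Y Z]) = X p (\<lambda>q. \<theta> [Y] q + \<theta> [Z] q)"
    by (rule vector_field_eq_on_points[OF XF(1)]) (rule form_add[OF \<theta> XF(2,3)])
  also have "\<dots> = X p (\<theta> [Y]) + X p (\<theta> [Z])"
    by (intro vector_field_add form_smooth \<theta> XF p)
  finally show ?thesis
    using form_add[OF \<theta> lie_bracket_closed[OF XF(1,2)] lie_bracket_closed[OF XF(1,3)] p]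
    by (simp add: ext_deriv_two lie_bracket_add_right[OF XF]) (simp add: vf_add_def)
qed

lemma ext_deriv_add_left:
  assumes \<theta>: "\<theta> \<in> differential_forms A 1" and XF: "X \<in> VF" "Y \<in> VF" "Z \<in> VF" and p: "p \<in> points A"
  shows "ext_deriv A \<theta> [vf_add X Y, Z] p = ext_deriv A \<theta> [X, Z] p + ext_deriv A \<theta> [Y, Z] p"
  using ext_deriv_add_right[OF \<theta> XF(3,1,2) p] ext_deriv_antisym[OF \<theta> _ XF(3) p] XF vf_add_closed[OF XF(1,2)]
  by simp

lemma ext_deriv_diff_left:
  assumes \<theta>: "\<theta> \<in> differential_forms A 1" and XF: "X \<in> VF" "Y \<in> VF" "Z \<in> VF" and p: "p \<in> points A"
  shows "ext_deriv A \<theta> [vf_diff X Y, Z] p = ext_deriv A \<theta> [X, Z] p - ext_deriv A \<theta> [Y, Z] p"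
  using ext_deriv_add_left[OF \<theta> vf_diff_closed[OF XF(1,2)] XF(2,3) p] by (simp add: vf_diff_cancel)

lemma ext_deriv_diff_right:
  assumes \<theta>: "\<theta> \<in> differential_forms A 1" and XF: "X \<in> VF" "Y \<in> VF" "Z \<in> VF" and p: "p \<in> points A"
  shows "ext_deriv A \<theta> [X, vf_diff Y Z] p = ext_deriv A \<theta> [X, Y] p - ext_deriv A \<theta> [X, Z] p"
  using ext_deriv_add_right[OF \<theta> XF(1) vf_diff_closed[OF XF(2,3)] XF(3) p] by (simp add: vf_diff_cancel)

lemma ext_deriv_smooth:
  assumes \<theta>: "\<theta> \<in> differential_forms A 1" and XF: "X \<in> VF" "Y \<in> VF" and p: "p \<in> points A"
  shows "smooth_near A p (ext_deriv A \<theta> [X, Y])"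
proof -
  have "ext_deriv A \<theta> [X, Y] = (\<lambda>q. X q (\<theta> [Y]) - Y q (\<theta> [X]) - \<theta> [lie_bracket A X Y] q)"
    by (simp add: fun_eq_iff ext_deriv_two)
  then show ?thesis
    using vector_field_smooth[OF XF(1) form_smooth[OF \<theta> XF(2) p]]
      vector_field_smooth[OF XF(2) form_smooth[OF \<theta> XF(1) p]]
      form_smooth[OF \<theta> lie_bracket_closed[OF XF] p]
    by (simp add: smooth_near_diff)
qed

text \<open>The formula \<open>d L\<^sub>S\<theta> = L\<^sub>S d\<theta>\<close>: the terms with one vector field applied to another cancel, and those
  with \<open>\<theta>\<close> of a double bracket match by the Jacobi identity.\<close>

lemma ext_deriv_lie_form:
  assumes \<theta>: "\<theta> \<in> differential_forms A 1" and XF: "S \<in> VF" "X \<in> VF" "Y \<in> VF" and p: "p \<in> points A"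
  shows "ext_deriv A (lie_form A S \<theta>) [X, Y] p = S p (ext_deriv A \<theta> [X, Y]) -
    ext_deriv A \<theta> [lie_bracket A S X, Y] p - ext_deriv A \<theta> [X, lie_bracket A S Y] p"
proof -
  have lie: "lie_form A S \<theta> [Z] = (\<lambda>q. S q (\<theta> [Z]) - \<theta> [lie_bracket A S Z] q)" for Z
    by (simp add: lie_form_def fun_eq_iff)
  note s = form_smooth[OF \<theta> _ p] and br = lie_bracket_closed[OF XF(1)]
  have apply_lie: "Z p (\<lambda>q. S q (\<theta> [Z']) - \<theta> [lie_bracket A S Z'] q) =
      Z p (\<lambda>q. S q (\<theta> [Z'])) - Z p (\<theta> [lie_bracket A S Z'])" if "Z \<in> VF" "Z' \<in> VF" for Z Z'
    by (rule vector_field_diff[OF that(1) vector_field_smooth[OF XF(1) s[OF that(2)]] s[OF br[OF that(2)]]])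
  have "S p (ext_deriv A \<theta> [X, Y]) =
      S p (\<lambda>q. X q (\<theta> [Y])) - S p (\<lambda>q. Y q (\<theta> [X])) - S p (\<theta> [lie_bracket A X Y])"
  proof -
    have "ext_deriv A \<theta> [X, Y] = (\<lambda>q. X q (\<theta> [Y]) - Y q (\<theta> [X]) - \<theta> [lie_bracket A X Y] q)"
      by (simp add: fun_eq_iff ext_deriv_two)
    moreover have "smooth_near A p (\<lambda>q. X q (\<theta> [Y]))" "smooth_near A p (\<lambda>q. Y q (\<theta> [X]))"
      "smooth_near A p (\<theta> [lie_bracket A X Y])"
      using vector_field_smooth[OF XF(2) s[OF XF(3)]] vector_field_smooth[OF XF(3) s[OF XF(2)]]
        s[OF lie_bracket_closed[OF XF(2,3)]] by simp_all
    ultimately show ?thesis by (simp add: vector_field_diff[OF XF(1)] smooth_near_diff)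
  qed
  moreover have "\<theta> [lie_bracket A S (lie_bracket A X Y)] p =
      \<theta> [lie_bracket A (lie_bracket A S X) Y] p + \<theta> [lie_bracket A X (lie_bracket A S Y)] p"
    unfolding jacobi[OF XF] by (intro form_add \<theta> lie_bracket_closed XF p)
  ultimately show ?thesis
    by (simp add: ext_deriv_two lie apply_lie XF lie_bracket_apply s)
qed

end

section \<open>Vertical fields and the projectors of a semispray\<close>

locale semispray_geometry = slit_bundle A for A :: "('p, real^'n) atlas" +
  fixes S :: "'p tpoint vfield"
  assumes semispray: "semispray A S"
begin

abbreviation "VB \<equiv> vector_fields B"
abbreviation "J \<equiv> tangent_structure A"
abbreviation "h \<equiv> hor A S"
abbreviation "v \<equiv> ver A S"
abbreviation "D \<equiv> lie_bracket B S"
abbreviation "zero \<equiv> (\<lambda>u f. 0) :: 'p tpoint vfield"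
abbreviation "N \<equiv> lie_tensor B S J"

definition vertical :: "'p tpoint vfield \<Rightarrow> bool" where
  "vertical Z \<longleftrightarrow> Z \<in> VB \<and> (\<forall>u g. u \<in> points B \<longrightarrow> smooth_near A (fst u) g \<longrightarrow> Z u (g \<circ> fst) = 0)"

lemma S_closed: "S \<in> VB"
  using semispray by (simp add: semispray_def)

lemma D_closed: "X \<in> VB \<Longrightarrow> D X \<in> VB"
  by (rule slit.lie_bracket_closed[OF S_closed])

lemma vertical_closed: "vertical Z \<Longrightarrow> Z \<in> VB"
  by (simp add: vertical_def)

lemma vf_eqI:
  assumes "X \<in> VB" "Y \<in> VB"
    and "\<And>u g. u \<in> points B \<Longrightarrow> smooth_near A (fst u) g \<Longrightarrow> X u (g \<circ> fst) = Y u (g \<circ> fst)"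
    and "\<And>u g. u \<in> points B \<Longrightarrow> smooth_near A (fst u) g \<Longrightarrow> X u (lift g) = Y u (lift g)"
  shows "X = Y"
proof (intro ext)
  fix u f
  show "X u f = Y u f"
  proof (cases "u \<in> points B")
    case True
    then have "X u = Y u"
      using assms by (intro slit_tangent_eqI[OF True]) (auto simp: slit.vector_field_tangent)
    then show ?thesis by simp
  qed (simp add: slit.vector_field_outside assms)
qed

lemma J_pullback: "X \<in> VB \<Longrightarrow> u \<in> points B \<Longrightarrow> smooth_near A (fst u) g \<Longrightarrow> J X u (g \<circ> fst) = 0"
  by (rule tangent_structure_apply(2)) (auto intro: slit.vector_field_tangent)

lemma J_lift: "X \<in> VB \<Longrightarrow> u \<in> points B \<Longrightarrow> smooth_near A (fst u) g \<Longrightarrow> J X u (lift g) = X u (g \<circ> fst)"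
  by (rule tangent_structure_apply(3)) (auto intro: slit.vector_field_tangent)

lemma J_vertical: "X \<in> VB \<Longrightarrow> vertical (J X)"
  by (simp add: vertical_def tangent_structure_closed J_pullback)

lemma zero_closed: "zero \<in> VB"
  using slit.vf_linear_combination[OF S_closed S_closed, of 0 0] by simp

lemma J_eq_zero: "vertical Z \<Longrightarrow> J Z = zero"
  by (rule vf_eqI) (auto simp: vertical_closed tangent_structure_closed zero_closed J_pullback J_lift
      vertical_def)

lemma J_diff: "J (vf_diff X Y) = vf_diff (J X) (J Y)"
  by (simp add: tangent_structure_def vf_diff_def fun_eq_iff Let_def sum_subtractf left_diff_distrib)

text \<open>Vector fields are local, and \<open>g\<close> is smooth near the base points of all \<open>w\<close> close to \<open>u\<close>. This
  is used to evaluate \<open>X(Z(g \<circ> \<pi>))\<close>, where the inner function is known only where \<open>g\<close> is smooth.\<close>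

lemma apply_to_pullback:
  assumes X: "X \<in> VB" and u: "u \<in> points B" and g: "smooth_near A (fst u) g"
    and eq: "\<And>w. w \<in> points B \<Longrightarrow> smooth_near A (fst w) g \<Longrightarrow> f w = k w"
  shows "X u f = X u k"
proof -
  obtain W where W: "openin (atlas_topology A) W" "fst u \<in> W" "\<And>q. q \<in> W \<Longrightarrow> smooth_near A q g"
    using smooth_near_open[OF g] by blast
  note op = slit_over_open[OF W(1)]
  show ?thesis
    by (rule slit.vector_field_cong[OF X op slit_pointD(3)[OF u W(2)]])
      (use eq W(3) slit.openin_subset_points[OF op] in \<open>auto simp: slit_over_def\<close>)
qed

lemma bracket_pullback:
  assumes "X \<in> VB" "Y \<in> VB" "u \<in> points B" "smooth_near A (fst u) g"
  shows "lie_bracket B X Y u (g \<circ> fst) = X u (\<lambda>w. Y w (g \<circ> fst)) - Y u (\<lambda>w. X w (g \<circ> fst))"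
  by (rule slit.lie_bracket_apply) (rule pullback_smooth[OF assms(3,4)])

lemma apply_zero_pullback:
  assumes "X \<in> VB" "vertical Z" "u \<in> points B" "smooth_near A (fst u) g"
  shows "X u (\<lambda>w. Z w (g \<circ> fst)) = 0"
proof -
  have "X u (\<lambda>w. Z w (g \<circ> fst)) = X u (\<lambda>w. 0)"
    by (rule apply_to_pullback[OF assms(1,3,4)]) (use assms(2) in \<open>auto simp: vertical_def\<close>)
  then show ?thesis
    using slit.tangent_const[OF slit.vector_field_tangent[OF assms(1)] assms(3)] by simp
qed

lemma apply_S_pullback:
  assumes "X \<in> VB" "u \<in> points B" "smooth_near A (fst u) g"
  shows "X u (\<lambda>w. S w (g \<circ> fst)) = X u (lift g)"
  by (rule apply_to_pullback[OF assms]) (rule semispray_pullback[OF semispray])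

text \<open>The vertical distribution is integrable.\<close>

lemma bracket_vertical: "vertical Y \<Longrightarrow> vertical Z \<Longrightarrow> vertical (lie_bracket B Y Z)"
  unfolding vertical_def[of "lie_bracket B Y Z"]
  by (auto simp: slit.lie_bracket_closed vertical_closed bracket_pullback apply_zero_pullback)

lemma D_vertical_pullback:
  assumes "vertical Z" "u \<in> points B" "smooth_near A (fst u) g"
  shows "D Z u (g \<circ> fst) = - Z u (lift g)"
  using assms by (simp add: bracket_pullback S_closed vertical_closed apply_zero_pullback apply_S_pullback)

text \<open>The key identity \<open>J[S, Z] = -Z\<close>. On a lift: \<open>[S, Z](g \<circ> \<pi>) = S(Z(g \<circ> \<pi>)) - Z(S(g \<circ> \<pi>)) = -Z(lift g)\<close>.\<close>

lemma J_D_vertical: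
  assumes Z: "vertical Z"
  shows "J (D Z) = (\<lambda>u f. - Z u f)"
proof -
  have "(\<lambda>u f. - Z u f) \<in> VB"
    using slit.vf_linear_combination[OF vertical_closed[OF Z] S_closed, of "-1" 0] by simp
  then show ?thesis
    using Z by (intro vf_eqI)
      (auto simp: tangent_structure_closed D_closed vertical_closed J_pullback J_lift
        D_vertical_pullback vertical_def[of Z])
qed

lemma N_eq: "N X = vf_diff (D (J X)) (J (D X))"
  by (simp add: lie_tensor_def)

lemma N_closed: "X \<in> VB \<Longrightarrow> N X \<in> VB"
  by (simp add: N_eq slit.vf_diff_closed D_closed tangent_structure_closed)

lemma N_diff: "X \<in> VB \<Longrightarrow> Y \<in> VB \<Longrightarrow> N (vf_diff X Y) = vf_diff (N X) (N Y)"
  by (simp add: N_eq J_diff slit.lie_bracket_diff_right S_closed D_closed tangent_structure_closed)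
    (simp add: vf_diff_def fun_eq_iff)

text \<open>Together with the next lemma this yields the splitting: \<open>N\<close> is \<open>1\<close> on vertical fields and \<open>-1\<close> modulo
  vertical fields, so \<open>(1 + N)/2\<close> is a projector onto the vertical fields.\<close>

lemma N_vertical:
  assumes "vertical Z"
  shows "N Z = Z"
  by (simp add: N_eq J_eq_zero[OF assms] J_D_vertical[OF assms] slit.lie_bracket_zero_right[OF S_closed])
    (simp add: vf_diff_def)

lemma N_pullback:
  assumes "X \<in> VB" "u \<in> points B" "smooth_near A (fst u) g"
  shows "N X u (g \<circ> fst) = - X u (g \<circ> fst)"
  using assms J_vertical[OF assms(1)]
  by (simp add: N_eq vf_diff_def D_vertical_pullback J_pullback J_lift D_closed)

lemma h_eq: "h X = (\<lambda>u f. (X u f - N X u f) / 2)"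
  by (simp add: hor_def vf_scale_def vf_diff_def fun_eq_iff)

lemma v_eq: "v X = (\<lambda>u f. (X u f + N X u f) / 2)"
  by (simp add: ver_def vf_scale_def vf_add_def fun_eq_iff)

lemma h_closed: "X \<in> VB \<Longrightarrow> h X \<in> VB"
  by (simp add: hor_def slit.vf_scale_closed slit.vf_diff_closed N_closed)

lemma v_closed: "X \<in> VB \<Longrightarrow> v X \<in> VB"
  by (simp add: ver_def slit.vf_scale_closed slit.vf_add_closed N_closed)

lemma v_vertical: "X \<in> VB \<Longrightarrow> vertical (v X)"
  using v_closed by (auto simp: vertical_def v_eq N_pullback)

lemma decomposition: "vf_add (h X) (v X) = X"
  by (simp add: vf_add_def h_eq v_eq fun_eq_iff field_simps)

lemma h_eq_diff: "h X = vf_diff X (v X)"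
  by (simp add: vf_diff_def h_eq v_eq fun_eq_iff field_simps)

lemma N_eq_projectors: "N X = vf_diff (v X) (h X)"
  by (simp add: vf_diff_def h_eq v_eq fun_eq_iff field_simps)

lemma v_of_vertical: "vertical Z \<Longrightarrow> v Z = Z"
  by (simp add: v_eq N_vertical)

lemma v_diff: "X \<in> VB \<Longrightarrow> Y \<in> VB \<Longrightarrow> v (vf_diff X Y) = vf_diff (v X) (v Y)"
  by (simp add: v_eq N_diff) (simp add: vf_diff_def fun_eq_iff field_simps)

lemma v_h: "X \<in> VB \<Longrightarrow> v (h X) = zero"
  by (simp add: h_eq_diff v_diff v_closed v_of_vertical v_vertical) (simp add: vf_diff_def)

lemma h_h: "X \<in> VB \<Longrightarrow> h (h X) = h X"
  using h_eq_diff[of "h X"] v_h[of X] by (simp add: vf_diff_def)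

text \<open>The other term of \<open>\<Phi> = v \<circ> (D h - h D)\<close> is killed since \<open>v h = 0\<close>.\<close>

lemma jacobi_endo_eq: "X \<in> VB \<Longrightarrow> jacobi_endo A S X = v (D (h X))"
  by (simp add: jacobi_endo_def lie_tensor_def v_diff D_closed h_closed v_h) (simp add: vf_diff_def)

lemma nabla_closed: "X \<in> VB \<Longrightarrow> nabla_vf A S X \<in> VB"
  by (simp add: nabla_vf_def slit.vf_add_closed h_closed v_closed D_closed)

text \<open>The four blocks of \<open>D\<close> relative to the splitting: \<open>\<nabla>\<close> collects the diagonal ones, \<open>\<Phi>\<close> and
  \<open>K = h D v\<close> are the other two.\<close>

lemma D_decomposition:
  assumes "X \<in> VB"
  shows "D X = vf_add (nabla_vf A S X) (vf_add (jacobi_endo A S X) (h (D (v X))))"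
proof -
  have "D X = vf_add (D (h X)) (D (v X))"
    using slit.lie_bracket_add_right[OF S_closed h_closed[OF assms] v_closed[OF assms]]
    by (simp add: decomposition)
  also have "\<dots> = vf_add (vf_add (h (D (h X))) (v (D (h X)))) (vf_add (h (D (v X))) (v (D (v X))))"
    by (simp add: decomposition)
  finally show ?thesis
    by (simp add: nabla_vf_def jacobi_endo_eq[OF assms] vf_add_def fun_eq_iff)
qed

text \<open>That is, \<open>JK = -v\<close>. It allows a vertical argument of a form to be traded for \<open>J\<close> of a horizontal one.\<close>

lemma J_h_D_v:
  assumes "X \<in> VB"
  shows "J (h (D (v X))) = (\<lambda>u f. - v X u f)"
  using assms
  by (simp add: h_eq_diff J_diff J_eq_zero v_vertical D_closed v_closed J_D_vertical) (simp add: vf_diff_def)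

end

section \<open>Semi-basic forms and the Helmholtz conditions\<close>

locale semi_basic_form = semispray_geometry A S for A :: "('p, real^'n) atlas" and S +
  fixes \<theta> :: "'p tpoint form"
  assumes semi_basic: "semi_basic A \<theta>"
begin

abbreviation "\<omega> \<equiv> ext_deriv B \<theta>"

lemma form: "\<theta> \<in> differential_forms B 1"
  using semi_basic by (simp add: semi_basic_def)

lemma form_vertical:
  assumes Z: "vertical Z" and u: "u \<in> points B"
  shows "\<theta> [Z] u = 0"
proof -
  have "Z u (g \<circ> fst) = 0" if "smooth_near A (fst u) g" for g
    using Z u that by (simp only: vertical_def)
  then have "Z u \<in> vertical_space A u"
    using slit.vector_field_tangent[OF vertical_closed[OF Z]]
    by (simp add: vertical_space_def differential_def fun_eq_iff)
  then show ?thesis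
    using semi_basic u vertical_closed[OF Z] by (auto simp: semi_basic_def)
qed

lemmas add_left = slit.ext_deriv_add_left[OF form]
lemmas add_right = slit.ext_deriv_add_right[OF form]
lemmas diff_left = slit.ext_deriv_diff_left[OF form]
lemmas diff_right = slit.ext_deriv_diff_right[OF form]

lemma vertical_vertical:
  assumes "vertical Y" "vertical Z" "u \<in> points B"
  shows "\<omega> [Y, Z] u = 0"
  using assms bracket_vertical[OF assms(1,2)]
    slit.vector_field_vanishing[OF vertical_closed[OF assms(1)], of "\<theta> [Z]" u]
    slit.vector_field_vanishing[OF vertical_closed[OF assms(2)], of "\<theta> [Y]" u]
  by (simp add: ext_deriv_two form_vertical)

lemma zero_left: "X \<in> VB \<Longrightarrow> u \<in> points B \<Longrightarrow> \<omega> [zero, X] u = 0"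
  using diff_left[of X X X u] by (simp add: vf_diff_def)

lemma zero_right: "X \<in> VB \<Longrightarrow> u \<in> points B \<Longrightarrow> \<omega> [X, zero] u = 0"
  using diff_right[of X X X u] by (simp add: vf_diff_def)

lemma minus_left:
  assumes "X \<in> VB" "Y \<in> VB" "u \<in> points B"
  shows "\<omega> [\<lambda>w f. - X w f, Y] u = - \<omega> [X, Y] u"
  using diff_left[OF zero_closed assms(1,2,3)] zero_left[OF assms(2,3)] by (simp add: vf_diff_def)

lemma minus_right:
  assumes "X \<in> VB" "Y \<in> VB" "u \<in> points B"
  shows "\<omega> [X, \<lambda>w f. - Y w f] u = - \<omega> [X, Y] u"
  using diff_right[OF assms(1) zero_closed assms(2,3)] zero_right[OF assms(1,3)] by (simp add: vf_diff_def)

text \<open>The fourth term, with two vertical arguments, is zero.\<close>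

lemma split:
  assumes "X \<in> VB" "Y \<in> VB" "u \<in> points B"
  shows "\<omega> [X, Y] u = \<omega> [h X, h Y] u + \<omega> [h X, v Y] u + \<omega> [v X, h Y] u"
proof -
  note c = h_closed[OF assms(1)] v_closed[OF assms(1)] h_closed[OF assms(2)] v_closed[OF assms(2)]
  have "\<omega> [X, Y] u = \<omega> [vf_add (h X) (v X), vf_add (h Y) (v Y)] u"
    by (simp add: decomposition)
  also have "\<dots> = \<omega> [h X, h Y] u + \<omega> [h X, v Y] u + (\<omega> [v X, h Y] u + \<omega> [v X, v Y] u)"
    using assms c by (simp add: add_left add_right slit.vf_add_closed del: decomposition)
  finally show ?thesis using vertical_vertical[OF v_vertical v_vertical] assms by simp
qed

lemma split_left:
  assumes "X \<in> VB" "Y \<in> VB" "u \<in> points B"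
  shows "\<omega> [X, Y] u = \<omega> [h X, Y] u + \<omega> [v X, Y] u"
  using add_left[OF h_closed[OF assms(1)] v_closed[OF assms(1)] assms(2,3)] by (simp add: decomposition)

lemma split_right:
  assumes "X \<in> VB" "Y \<in> VB" "u \<in> points B"
  shows "\<omega> [X, Y] u = \<omega> [X, h Y] u + \<omega> [X, v Y] u"
  using add_right[OF assms(1) h_closed[OF assms(2)] v_closed[OF assms(2)] assms(3)] by (simp add: decomposition)

text \<open>Here \<open>i\<^sub>T\<theta> = 0\<close>, so \<open>d\<^sub>T\<theta> = i\<^sub>T d\<theta>\<close>.\<close>

lemma tensor_deriv_vertical_valued:
  assumes T: "\<And>Z. Z \<in> VB \<Longrightarrow> vertical (T Z)" and XY: "X \<in> VB" "Y \<in> VB" "u \<in> points B"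
  shows "tensor_deriv B T \<theta> [X, Y] u = \<omega> [T X, Y] u + \<omega> [X, T Y] u"
  using slit.vector_field_vanishing[OF XY(1), of "\<theta> [T Y]" u] slit.vector_field_vanishing[OF XY(2), of "\<theta> [T X]" u]
  by (simp add: tensor_deriv_two form_vertical T XY slit.lie_bracket_closed)

lemma form_h:
  assumes "X \<in> VB" "u \<in> points B"
  shows "\<theta> [h X] u = \<theta> [X] u"
  using slit.form_add[OF form h_closed[OF assms(1)] v_closed[OF assms(1)] assms(2)]
    form_vertical[OF v_vertical[OF assms(1)] assms(2)] by (simp add: decomposition)

text \<open>Here \<open>i\<^sub>h\<theta> = \<theta>\<close>, so \<open>d\<^sub>h\<theta> = i\<^sub>h\<omega> - \<omega>\<close>; expanding both terms along the splitting leaves the purely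
  horizontal part.\<close>

lemma tensor_deriv_h:
  assumes XY: "X \<in> VB" "Y \<in> VB" "u \<in> points B"
  shows "tensor_deriv B h \<theta> [X, Y] u = \<omega> [h X, h Y] u"
proof -
  have "X u (\<theta> [h Y]) = X u (\<theta> [Y])"
    by (rule slit.vector_field_eq_on_points[OF XY(1)]) (rule form_h[OF XY(2)])
  moreover have "Y u (\<theta> [h X]) = Y u (\<theta> [X])"
    by (rule slit.vector_field_eq_on_points[OF XY(2)]) (rule form_h[OF XY(1)])
  ultimately have "tensor_deriv B h \<theta> [X, Y] u = \<omega> [h X, Y] u + \<omega> [X, h Y] u - \<omega> [X, Y] u"
    unfolding tensor_deriv_two ext_deriv_two[of B \<theta> X Y]
    by (simp add: form_h slit.lie_bracket_closed XY)
  then show ?thesis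
    using split[OF XY] split_right[OF h_closed[OF XY(1)] XY(2,3)] split_left[OF XY(1) h_closed[OF XY(2)] XY(3)]
    by simp
qed

lemma tensor_deriv_J:
  assumes "X \<in> VB" "Y \<in> VB" "u \<in> points B"
  shows "tensor_deriv B J \<theta> [X, Y] u = \<omega> [J X, Y] u + \<omega> [X, J Y] u"
  by (rule tensor_deriv_vertical_valued[OF J_vertical assms])

lemma jacobi_endo_vertical: "X \<in> VB \<Longrightarrow> vertical (jacobi_endo A S X)"
  by (simp add: jacobi_endo_eq v_vertical D_closed h_closed)

lemma tensor_deriv_jacobi_endo:
  assumes "X \<in> VB" "Y \<in> VB" "u \<in> points B"
  shows "tensor_deriv B (jacobi_endo A S) \<theta> [X, Y] u =
    \<omega> [jacobi_endo A S X, Y] u + \<omega> [X, jacobi_endo A S Y] u"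
  by (rule tensor_deriv_vertical_valued[OF jacobi_endo_vertical assms])

lemma nabla_two:
  "nabla_form A S \<alpha> [X, Y] u = S u (\<alpha> [X, Y]) - \<alpha> [nabla_vf A S X, Y] u - \<alpha> [X, nabla_vf A S Y] u"
  by (simp add: nabla_form_def numeral_2_eq_2 lessThan_Suc)

lemmas lie_two = slit.ext_deriv_lie_form[OF form S_closed]

text \<open>The contribution of \<open>K\<close> vanishes: \<open>KX\<close> is horizontal and \<open>vX = -J(KX)\<close>, so
  \<open>\<omega>(KX,Y) + \<omega>(X,KY) = \<omega>(KX,vY) + \<omega>(vX,KY) = -(\<omega>(KX,J(KY)) + \<omega>(J(KX),KY)) = 0\<close>.\<close>

lemma lie_eq_nabla_minus_jacobi:
  assumes dh: "\<And>X Y u. X \<in> VB \<Longrightarrow> Y \<in> VB \<Longrightarrow> u \<in> points B \<Longrightarrow> \<omega> [h X, h Y] u = 0"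
    and dJ: "\<And>X Y u. X \<in> VB \<Longrightarrow> Y \<in> VB \<Longrightarrow> u \<in> points B \<Longrightarrow> \<omega> [J X, Y] u + \<omega> [X, J Y] u = 0"
    and XY: "X \<in> VB" "Y \<in> VB" "u \<in> points B"
  shows "ext_deriv B (lie_form B S \<theta>) [X, Y] u = nabla_form A S \<omega> [X, Y] u -
    (\<omega> [jacobi_endo A S X, Y] u + \<omega> [X, jacobi_endo A S Y] u)"
proof -
  let ?K = "\<lambda>X. h (D (v X))" and ?\<Phi> = "jacobi_endo A S"
  have K: "?K Z \<in> VB" if "Z \<in> VB" for Z
    by (intro h_closed D_closed v_closed that)
  have \<Phi>: "?\<Phi> Z \<in> VB" if "Z \<in> VB" for Z
    by (rule vertical_closed[OF jacobi_endo_vertical[OF that]])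
  note cl = K \<Phi> nabla_closed slit.vf_add_closed XY
  have Kh: "\<omega> [?K Z, h W] u = 0" "\<omega> [h W, ?K Z] u = 0" if "Z \<in> VB" "W \<in> VB" for Z W
    by (rule dh; use that XY in \<open>simp add: D_closed v_closed\<close>)+
  have "\<omega> [?K X, Y] u = \<omega> [?K X, v Y] u"
    using split_right[OF K[OF XY(1)] XY(2,3)] Kh(1)[OF XY(1,2)] by simp
  also have "\<dots> = - \<omega> [?K X, J (?K Y)] u"
    using minus_right[OF K[OF XY(1)] v_closed[OF XY(2)] XY(3)] by (simp add: J_h_D_v XY)
  finally have 1: "\<omega> [?K X, Y] u = - \<omega> [?K X, J (?K Y)] u" .
  have "\<omega> [X, ?K Y] u = \<omega> [v X, ?K Y] u"
    using split_left[OF XY(1) K[OF XY(2)] XY(3)] Kh(2)[OF XY(2,1)] by simp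
  also have "\<dots> = - \<omega> [J (?K X), ?K Y] u"
    using minus_left[OF v_closed[OF XY(1)] K[OF XY(2)] XY(3)] by (simp add: J_h_D_v XY)
  finally have "\<omega> [?K X, Y] u + \<omega> [X, ?K Y] u = 0"
    using dJ[OF K[OF XY(1)] K[OF XY(2)] XY(3)] 1 by simp
  moreover have "\<omega> [D X, Y] u = \<omega> [nabla_vf A S X, Y] u + (\<omega> [?\<Phi> X, Y] u + \<omega> [?K X, Y] u)"
    unfolding D_decomposition[OF XY(1)] by (simp add: add_left cl)
  moreover have "\<omega> [X, D Y] u = \<omega> [X, nabla_vf A S Y] u + (\<omega> [X, ?\<Phi> Y] u + \<omega> [X, ?K Y] u)"
    unfolding D_decomposition[OF XY(2)] by (simp add: add_right cl)
  ultimately show ?thesis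
    by (simp add: lie_two[OF XY] nabla_two)
qed

context
  assumes closed: "\<And>X Y u. X \<in> VB \<Longrightarrow> Y \<in> VB \<Longrightarrow> u \<in> points B \<Longrightarrow>
    ext_deriv B (lie_form B S \<theta>) [X, Y] u = 0"
begin

lemma invariant:
  "X \<in> VB \<Longrightarrow> Y \<in> VB \<Longrightarrow> u \<in> points B \<Longrightarrow> S u (\<omega> [X, Y]) = \<omega> [D X, Y] u + \<omega> [X, D Y] u"
  using closed[of X Y u] lie_two[of X Y u] by simp

text \<open>Apply the invariance of \<open>\<omega>\<close> to \<open>\<omega>(JX,JY) = 0\<close> and use that \<open>[S,JX]\<close> is \<open>-X\<close> up to a vertical field.\<close>

lemma closed_imp_dJ:
  assumes XY: "X \<in> VB" "Y \<in> VB" "u \<in> points B"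
  shows "\<omega> [J X, Y] u + \<omega> [X, J Y] u = 0"
proof -
  note J = tangent_structure_closed
  have D: "\<exists>Z. vertical Z \<and> vf_diff Z X = D (J X)" if X: "X \<in> VB" for X
  proof (intro exI conjI)
    show "vertical (vf_add (D (J X)) X)"
      using X J_vertical[OF X]
      by (auto simp: vertical_def[of "vf_add _ _"] slit.vf_add_closed D_closed J)
        (simp add: vf_add_def D_vertical_pullback J_lift)
  qed (simp add: vf_add_def vf_diff_def)
  obtain Z where Z: "vertical Z" "vf_diff Z X = D (J X)" using D[OF XY(1)] by blast
  obtain W where W: "vertical W" "vf_diff W Y = D (J Y)" using D[OF XY(2)] by blast
  have "S u (\<omega> [J X, J Y]) = 0"
    by (rule slit.vector_field_vanishing[OF S_closed])
      (rule vertical_vertical[OF J_vertical[OF XY(1)] J_vertical[OF XY(2)]])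
  then have "\<omega> [D (J X), J Y] u + \<omega> [J X, D (J Y)] u = 0"
    using invariant[OF J[OF XY(1)] J[OF XY(2)] XY(3)] by simp
  then show ?thesis
    unfolding Z(2)[symmetric] W(2)[symmetric]
    using vertical_vertical[OF Z(1) J_vertical[OF XY(2)] XY(3)]
      vertical_vertical[OF J_vertical[OF XY(1)] W(1) XY(3)]
    by (simp add: diff_left diff_right vertical_closed[OF Z(1)] vertical_closed[OF W(1)] XY J)
qed

text \<open>The commutator of \<open>L\<^sub>S\<close> with \<open>i\<^sub>J\<close> is \<open>i\<^sub>N\<close>, so \<open>i\<^sub>N\<omega> = 0\<close>; and \<open>N\<close> is \<open>-1\<close> on horizontal fields.\<close>

lemma closed_imp_dh:
  assumes XY: "X \<in> VB" "Y \<in> VB" "u \<in> points B"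
  shows "\<omega> [h X, h Y] u = 0"
proof -
  note J = tangent_structure_closed
  have N: "\<omega> [N X, Y] u + \<omega> [X, N Y] u = 0" if XY: "X \<in> VB" "Y \<in> VB" for X Y
  proof -
    have sm: "smooth_near B u (\<omega> [P, Q])" if "P \<in> VB" "Q \<in> VB" for P Q
      by (rule slit.ext_deriv_smooth[OF form that \<open>u \<in> points B\<close>])
    have "S u (\<omega> [J X, Y]) + S u (\<omega> [X, J Y]) = S u (\<lambda>w. \<omega> [J X, Y] w + \<omega> [X, J Y] w)"
      by (rule slit.vector_field_add[OF S_closed sm[OF J[OF XY(1)] XY(2)] sm[OF XY(1) J[OF XY(2)]], symmetric])
    also have "\<dots> = 0"
      by (rule slit.vector_field_vanishing[OF S_closed]) (rule closed_imp_dJ[OF XY])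
    finally have "\<omega> [D (J X), Y] u + \<omega> [J X, D Y] u + (\<omega> [D X, J Y] u + \<omega> [X, D (J Y)] u) = 0"
      using invariant[OF J[OF XY(1)] XY(2) \<open>u \<in> points B\<close>] invariant[OF XY(1) J[OF XY(2)] \<open>u \<in> points B\<close>]
      by simp
    then show ?thesis
      using closed_imp_dJ[OF D_closed[OF XY(1)] XY(2) \<open>u \<in> points B\<close>]
        closed_imp_dJ[OF XY(1) D_closed[OF XY(2)] \<open>u \<in> points B\<close>]
      unfolding N_eq by (simp add: diff_left diff_right J D_closed XY \<open>u \<in> points B\<close>)
  qed
  have "N (h Z) = (\<lambda>w f. - h Z w f)" if "Z \<in> VB" for Z
    using that by (simp add: N_eq_projectors v_h h_h) (simp add: vf_diff_def)
  then show ?thesis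
    using N[OF h_closed[OF XY(1)] h_closed[OF XY(2)]]
    by (simp add: XY minus_left minus_right h_closed)
qed

text \<open>As \<open>\<Phi>\<close> is vertical and \<open>\<Phi>h = \<Phi>\<close>, the form \<open>i\<^sub>\<Phi>\<omega>\<close> sees only horizontal parts; there it equals
  \<open>\<nabla>\<omega>\<close>, which is zero because \<open>\<nabla>\<close> preserves horizontal fields, on which \<open>\<omega>\<close> vanishes.\<close>

lemma closed_imp_dPhi:
  assumes XY: "X \<in> VB" "Y \<in> VB" "u \<in> points B"
  shows "\<omega> [jacobi_endo A S X, Y] u + \<omega> [X, jacobi_endo A S Y] u = 0"
proof -
  let ?\<Phi> = "jacobi_endo A S"
  note \<Phi> = jacobi_endo_vertical
  have \<Phi>h: "?\<Phi> (h Z) = ?\<Phi> Z" if "Z \<in> VB" for Z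
    by (simp add: jacobi_endo_eq that h_closed h_h)
  have nabla_h: "nabla_vf A S (h Z) = h (D (h Z))" if "Z \<in> VB" for Z
    using v_of_vertical[of zero] that
    by (simp add: nabla_vf_def h_h v_h slit.lie_bracket_zero_right[OF S_closed] vertical_def zero_closed)
      (simp add: vf_add_def)
  have "\<omega> [?\<Phi> X, Y] u + \<omega> [X, ?\<Phi> Y] u = \<omega> [?\<Phi> X, h Y] u + \<omega> [h X, ?\<Phi> Y] u"
    using split_right[OF vertical_closed[OF \<Phi>[OF XY(1)]] XY(2,3)]
      split_left[OF XY(1) vertical_closed[OF \<Phi>[OF XY(2)]] XY(3)]
      vertical_vertical[OF \<Phi>[OF XY(1)] v_vertical[OF XY(2)] XY(3)]
      vertical_vertical[OF v_vertical[OF XY(1)] \<Phi>[OF XY(2)] XY(3)]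
    by simp
  also have "\<dots> = nabla_form A S \<omega> [h X, h Y] u"
    using lie_eq_nabla_minus_jacobi[OF closed_imp_dh closed_imp_dJ h_closed[OF XY(1)] h_closed[OF XY(2)] XY(3)]
      closed[OF h_closed[OF XY(1)] h_closed[OF XY(2)] XY(3)]
    by (simp add: \<Phi>h XY)
  also have "\<dots> = 0"
  proof -
    have "S u (\<omega> [h X, h Y]) = 0"
      by (rule slit.vector_field_vanishing[OF S_closed]) (rule closed_imp_dh[OF XY(1,2)])
    then show ?thesis
      by (simp add: nabla_two nabla_h XY closed_imp_dh D_closed h_closed)
  qed
  finally show ?thesis .
qed

end

lemma closed_iff_helmholtz:
  "closed_form B 1 (lie_form B S \<theta>) \<longleftrightarrow>
    vanishes B 2 (tensor_deriv B h \<theta>) \<and> vanishes B 2 (tensor_deriv B J \<theta>) \<and>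
    vanishes B 2 (nabla_form A S \<omega>) \<and> vanishes B 2 (tensor_deriv B (jacobi_endo A S) \<theta>)"
    (is "?closed \<longleftrightarrow> ?h \<and> ?J \<and> ?nabla \<and> ?Phi")
proof -
  have conds: "?closed \<longleftrightarrow> (\<forall>X\<in>VB. \<forall>Y\<in>VB. \<forall>u\<in>points B. ext_deriv B (lie_form B S \<theta>) [X, Y] u = 0)"
    "?h \<longleftrightarrow> (\<forall>X\<in>VB. \<forall>Y\<in>VB. \<forall>u\<in>points B. \<omega> [h X, h Y] u = 0)"
    "?J \<longleftrightarrow> (\<forall>X\<in>VB. \<forall>Y\<in>VB. \<forall>u\<in>points B. \<omega> [J X, Y] u + \<omega> [X, J Y] u = 0)"
    "?Phi \<longleftrightarrow> (\<forall>X\<in>VB. \<forall>Y\<in>VB. \<forall>u\<in>points B.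
      \<omega> [jacobi_endo A S X, Y] u + \<omega> [X, jacobi_endo A S Y] u = 0)"
    "?nabla \<longleftrightarrow> (\<forall>X\<in>VB. \<forall>Y\<in>VB. \<forall>u\<in>points B. nabla_form A S \<omega> [X, Y] u = 0)"
    unfolding closed_form_def Suc_1 vanishes_two_iff One_nat_def numeral_2_eq_2[symmetric]
    by (simp_all add: tensor_deriv_h tensor_deriv_J tensor_deriv_jacobi_endo)
  show ?thesis
  proof (intro iffI conjI)
    assume "?closed"
    then have closed: "ext_deriv B (lie_form B S \<theta>) [X, Y] u = 0" if "X \<in> VB" "Y \<in> VB" "u \<in> points B" for X Y u
      using conds(1) that by blast
    show ?h ?J ?Phi
      unfolding conds using closed_imp_dh closed_imp_dJ closed_imp_dPhi closed by blast+
    show ?nabla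
      unfolding conds
    proof (intro ballI)
      fix X Y u assume "X \<in> VB" "Y \<in> VB" "u \<in> points B"
      then show "nabla_form A S \<omega> [X, Y] u = 0"
        using lie_eq_nabla_minus_jacobi[OF closed_imp_dh[OF closed] closed_imp_dJ[OF closed], of X Y u]
          closed[of X Y u] closed_imp_dPhi[OF closed, of X Y u] by simp
    qed
  next
    assume *: "?h \<and> ?J \<and> ?nabla \<and> ?Phi"
    have dh: "\<omega> [h X, h Y] u = 0" and dJ: "\<omega> [J X, Y] u + \<omega> [X, J Y] u = 0"
      and dn: "nabla_form A S \<omega> [X, Y] u = 0"
      and dP: "\<omega> [jacobi_endo A S X, Y] u + \<omega> [X, jacobi_endo A S Y] u = 0"
      if "X \<in> VB" "Y \<in> VB" "u \<in> points B" for X Y u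
      using * that unfolding conds by blast+
    show ?closed
      unfolding conds
    proof (intro ballI)
      fix X Y u assume XY: "X \<in> VB" "Y \<in> VB" "u \<in> points B"
      show "ext_deriv B (lie_form B S \<theta>) [X, Y] u = 0"
        using lie_eq_nabla_minus_jacobi[OF dh dJ XY] dn[OF XY] dP[OF XY] by simp
    qed
  qed
qed

end

theorem theorem4p1:
  fixes A :: "('a, real^'n) atlas"
    and S :: "'a tpoint vfield"
    and \<theta> :: "'a tpoint form"
  assumes "smooth_manifold A"
    and "semispray A S"
    and "semi_basic A \<theta>"
  shows "closed_form (slit_tangent_bundle A) 1 (lie_form (slit_tangent_bundle A) S \<theta>) \<longleftrightarrow>
    vanishes (slit_tangent_bundle A) 2 (tensor_deriv (slit_tangent_bundle A) (hor A S) \<theta>) \<and>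
    vanishes (slit_tangent_bundle A) 2
      (tensor_deriv (slit_tangent_bundle A) (tangent_structure A) \<theta>) \<and>
    vanishes (slit_tangent_bundle A) 2
      (nabla_form A S (ext_deriv (slit_tangent_bundle A) \<theta>)) \<and>
    vanishes (slit_tangent_bundle A) 2
      (tensor_deriv (slit_tangent_bundle A) (jacobi_endo A S) \<theta>)"
proof -
  interpret semi_basic_form A S \<theta>
    using assms by unfold_locales (auto simp: smooth_manifold_def)
  show ?thesis by (rule closed_iff_helmholtz)
qed

end
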